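(* Let $f$ be a complex-valued function on $(0,\infty)$ such that $$\frac{f(x)}{x}=\int_{-\pi}^{\pi}e^{-x\cosh(u)}\psi(u)\sinh(u)\,du,\qquad x>0,$$ where $\psi$ is a $2\pi$-periodic function satisfying, for an absolute constant $C>0$, $|\psi(u)-\psi(v)|\le C|u-v|$ for all $u,v\in[-\pi,\pi]$. Let the sequence $\{a_n\}_{n\ge1}$ be the Kontorovich-Lebedev transform of discrete variable $$a_n=\int_0^\infty K_{in}(x)f(x)\,\frac{dx}{x},\qquad n\in\mathbb{N},$$ and assume that $\sum_{n=1}^\infty|a_n|\,n^2e^{\theta_0 n}<\infty$ for every $\theta_0\in[0,\pi)$. Then the function $$u(r,\theta)=\frac{2}{\pi^2}\sum_{n=1}^\infty n\sinh(\theta n)\,J(r,in,\pi)\,a_n$$ solves the inhomogeneous Helmholtz equation (in polar coordinates) $$\frac{\partial^2u}{\partial r^2}+\frac1r\frac{\partial u}{\partial r}+\frac1{r^2}\frac{\partial^2u}{\partial\theta^2}-u=\frac{2\sinh(\pi)}{\pi^2r}\,e^{-\cosh(\pi)r}\sum_{n=1}^\infty(-1)^{n+1}n\sinh(n\theta)\,a_n$$ in the interior of the upper half-plane $r>0$, $0<\theta<\pi$, vanishes at infinity (i.e. as $r\to\infty$), and on the real axis takes the prescribed values $$u(r,0)=0,\qquad u(r,\pi)=f(r),\qquad r>0.$$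
   Context: $\mathbb{N}=\{1,2,\dots\}$ and $i$ is the imaginary unit. $K_\nu$ is the modified Bessel (Macdonald) function, $K_\nu(x)=\int_0^\infty e^{-x\cosh u}\cosh(\nu u)\,du$ for $x>0$, $\nu\in\mathbb{C}$; thus $K_{in}(x)=\int_0^\infty e^{-x\cosh u}\cos(nu)\,du$. The incomplete modified Bessel function is $J(z,\nu,w)=\int_0^w e^{-z\cosh u}\cosh(\nu u)\,du$; thus $J(r,in,\pi)=\int_0^\pi e^{-r\cosh u}\cos(nu)\,du$. *)

theory Defs
  imports "HOL-Analysis.Analysis"
begin

definition macdonald_K :: "complex \<Rightarrow> real \<Rightarrow> complex" where
  "macdonald_K \<nu> x =
     (LBINT u:{0<..}. complex_of_real (exp (- x * cosh u)) * cosh (\<nu> * complex_of_real u))"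

definition incomplete_J :: "complex \<Rightarrow> complex \<Rightarrow> real \<Rightarrow> complex" where
  "incomplete_J z \<nu> w =
     (LBINT u=0..w. exp (- z * complex_of_real (cosh u)) * cosh (\<nu> * complex_of_real u))"

definition kontorovich_lebedev :: "(real \<Rightarrow> complex) \<Rightarrow> nat \<Rightarrow> complex" where
  "kontorovich_lebedev f n =
     (LBINT x:{0<..}. macdonald_K (\<i> * of_nat n) x * f x / complex_of_real x)"

definition u_term :: "(nat \<Rightarrow> complex) \<Rightarrow> real \<Rightarrow> real \<Rightarrow> nat \<Rightarrow> complex" where
  "u_term a r \<theta> n =
     complex_of_real (real n * sinh (\<theta> * real n)) *
     incomplete_J (complex_of_real r) (\<i> * of_nat n) pi * a n"

definition source_term :: "(nat \<Rightarrow> complex) \<Rightarrow> real \<Rightarrow> nat \<Rightarrow> complex" where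
  "source_term a \<theta> n =
     complex_of_real ((-1) ^ (n + 1) * real n * sinh (real n * \<theta>)) * a n"

text \<open>
  The coefficients are indexed from 1, so sums over all positive integers are written with
  \<open>Suc n\<close>; the value \<open>a 0\<close> is never used.
\<close>

definition u_series :: "(nat \<Rightarrow> complex) \<Rightarrow> real \<Rightarrow> real \<Rightarrow> complex" where
  "u_series a r \<theta> = complex_of_real (2 / pi\<^sup>2) * (\<Sum>n. u_term a r \<theta> (Suc n))"

definition helmholtz_source :: "(nat \<Rightarrow> complex) \<Rightarrow> real \<Rightarrow> real \<Rightarrow> complex" where
  "helmholtz_source a r \<theta> =
     complex_of_real (2 * sinh pi / (pi\<^sup>2 * r) * exp (- cosh pi * r)) *
     (\<Sum>n. source_term a \<theta> (Suc n))"

text \<open>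
  Solutions on the open upper half-plane, in polar coordinates. The partial derivatives occurring
  in the equation are required to exist; they are unique because the domain is open.
\<close>

definition solves_helmholtz_polar ::
    "(real \<Rightarrow> real \<Rightarrow> complex) \<Rightarrow> (real \<Rightarrow> real \<Rightarrow> complex) \<Rightarrow> bool" where
  "solves_helmholtz_polar u g \<longleftrightarrow>
     (\<exists>u_r u_rr u_t u_tt :: real \<Rightarrow> real \<Rightarrow> complex.
        \<forall>r \<theta>. 0 < r \<and> 0 < \<theta> \<and> \<theta> < pi \<longrightarrow>
          ((\<lambda>s. u s \<theta>) has_vector_derivative u_r r \<theta>) (at r) \<and>
          ((\<lambda>s. u_r s \<theta>) has_vector_derivative u_rr r \<theta>) (at r) \<and>
          ((\<lambda>t. u r t) has_vector_derivative u_t r \<theta>) (at \<theta>) \<and>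
          ((\<lambda>t. u_t r t) has_vector_derivative u_tt r \<theta>) (at \<theta>) \<and>
          u_rr r \<theta> + u_r r \<theta> / complex_of_real r
            + u_tt r \<theta> / complex_of_real (r\<^sup>2) - u r \<theta> = g r \<theta>)"

end

theory Submission
  imports Defs "HOL-Complex_Analysis.Residue_Theorem"
begin

text \<open>
  Only the odd part of \<open>\<psi>\<close> enters the representation of \<open>f\<close>. With \<open>\<phi> u = \<psi> u - \<psi> (- u)\<close> on \<open>[0, pi]\<close>, the
  representation says that \<open>f r / r\<close> is the integral of \<open>\<phi>\<close> against \<open>sinh u * exp (- r * cosh u)\<close>.

  The residue theorem on a rectangle of height \<open>2 * pi\<close> evaluates the integral of
  \<open>cos (\<nu> * v) / (cosh u + cosh v)\<close> over \<open>v > 0\<close> (\<open>integral_cos_over_cosh_sum\<close>). By Fubini's theorem this is the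
  Laplace transform of the Macdonald function at \<open>cosh u\<close>, and a second use of Fubini's theorem gives
  \<open>sinh (pi * n) * a n = pi * b n\<close>, where \<open>b n\<close> is the integral of \<open>\<phi> u * sin (n * u)\<close> over \<open>[0, pi]\<close>
  (\<open>kontorovich_lebedev_of_laplace_representation\<close>).

  Write \<open>J n r\<close> for \<open>J(r, i n, pi)\<close>. Integration by parts shows that \<open>n * J n r\<close> is \<open>r\<close> times the \<open>n\<close>-th sine
  coefficient of \<open>sinh u * exp (- r * cosh u)\<close> (\<open>times_J_eq_sine_coeff\<close>). Hence the series at \<open>\<theta> = pi\<close> pairs the
  sine coefficients of two continuous functions, and Parseval's identity (\<open>sine_parseval\<close>) sums it
  to \<open>f r\<close>. That identity rests on the mean square density of sine polynomials, which follows from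
  Weierstrass' theorem applied to functions of \<open>cos u\<close>.

  A further integration by parts bounds \<open>n\<^sup>2 * J n r\<close> by a function of \<open>r\<close> that tends to 0 at infinity
  (\<open>sq_times_J_le\<close>). Since \<open>sinh (\<theta> * n) \<le> sinh (pi * n)\<close>, each term of the series is at most a constant times
  this function times \<open>cmod (b n) / n\<close>. These quotients are summable by Bessel's inequality, so the
  series converges absolutely for \<open>0 \<le> \<theta> \<le> pi\<close> and vanishes at infinity uniformly in \<open>\<theta>\<close>.

  For \<open>0 < \<theta> < pi\<close> the exponential decay of the coefficients justifies termwise differentiation. As a
  function of \<open>r\<close>, \<open>J n r\<close> satisfies the modified Bessel equation with index \<open>i n\<close>, up to the boundary term
  at \<open>u = pi\<close> of another integration by parts (\<open>J_bessel_equation\<close>). Multiplied by \<open>n * sinh (n * \<theta>) * a n\<close>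
  and summed, these boundary terms form the right-hand side of the Helmholtz equation.
\<close>

section \<open>Parseval's identity for sine series\<close>

text \<open>
  The unnormalised sine coefficient on the interval from 0 to \<open>pi\<close>; the Fourier sine coefficient is
  \<open>2 / pi\<close> times this value.
\<close>

definition sine_coeff :: "(real \<Rightarrow> real) \<Rightarrow> nat \<Rightarrow> real" where
  "sine_coeff \<phi> n = integral {0..pi} (\<lambda>u. \<phi> u * sin (real n * u))"

lemma has_integral_cos_multiple:
  fixes c :: real
  assumes "c \<noteq> 0" "c \<in> \<int>"
  shows "((\<lambda>u. cos (c * u)) has_integral 0) {0..pi}"
proof -
  have "((\<lambda>u. cos (c * u)) has_integral (sin (c * pi) / c - sin (c * 0) / c)) {0..pi}"
    using assms(1)
    by (intro fundamental_theorem_of_calculus)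
       (auto intro!: derivative_eq_intros simp flip: has_real_derivative_iff_has_vector_derivative)
  moreover have "sin (c * pi) = 0"
    using assms(2) unfolding sin_zero_iff_int2 Ints_def by auto
  ultimately show ?thesis by simp
qed

text \<open>
  Orthogonality of the sines. The index 0 is admitted, where both sides vanish, so that partial
  sums may run over \<open>{..N}\<close>.
\<close>

lemma has_integral_sin_sin:
  "((\<lambda>u. sin (real m * u) * sin (real n * u)) has_integral
     (if m = n \<and> n \<noteq> 0 then pi / 2 else 0)) {0..pi}"
proof (cases "m = 0 \<or> n = 0")
  case True
  then show ?thesis by auto
next
  case False
  have eq: "sin (real m * u) * sin (real n * u) =
      (cos ((real m - real n) * u) - cos ((real m + real n) * u)) / 2" for u
    by (simp add: sin_times_sin left_diff_distrib distrib_right)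
  have 1: "((\<lambda>u. cos ((real m + real n) * u)) has_integral 0) {0..pi}"
    using False by (intro has_integral_cos_multiple) auto
  have 2: "((\<lambda>u. cos ((real m - real n) * u)) has_integral (if m = n then pi else 0)) {0..pi}"
  proof (cases "m = n")
    case True
    then show ?thesis using has_integral_const_real[of "1::real" 0 pi] by simp
  next
    case False
    then show ?thesis by (auto intro!: has_integral_cos_multiple)
  qed
  have "((\<lambda>u. (cos ((real m - real n) * u) - cos ((real m + real n) * u)) / 2) has_integral
      ((if m = n then pi else 0) - 0) / 2) {0..pi}"
    by (intro has_integral_divide has_integral_diff 1 2)
  then show ?thesis using False unfolding eq by (auto split: if_splits)
qed

text \<open>
  The mean square distance from \<open>\<phi>\<close> to a sine sum is a quadratic polynomial in the coefficients \<open>p\<close>;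
  completing the square yields both Bessel's inequality and the optimality of the partial sums of
  the sine series.
\<close>

lemma integral_sq_diff_sine_sum:
  assumes "continuous_on {0..pi} \<phi>"
  shows "integral {0..pi} (\<lambda>u. (\<phi> u - (\<Sum>k\<le>N. p k * sin (real k * u)))\<^sup>2) =
    integral {0..pi} (\<lambda>u. (\<phi> u)\<^sup>2) - 2 * (\<Sum>k\<le>N. p k * sine_coeff \<phi> k)
      + pi / 2 * (\<Sum>k\<in>{1..N}. (p k)\<^sup>2)"
proof (rule integral_unique)
  have 1: "((\<lambda>u. (\<phi> u)\<^sup>2) has_integral integral {0..pi} (\<lambda>u. (\<phi> u)\<^sup>2)) {0..pi}"
    by (intro integrable_integral integrable_continuous_real continuous_intros assms)
  have 2: "((\<lambda>u. \<phi> u * sin (real k * u)) has_integral sine_coeff \<phi> k) {0..pi}" for k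
    unfolding sine_coeff_def
    by (intro integrable_integral integrable_continuous_real continuous_intros assms)
  have eq: "(\<phi> u - (\<Sum>k\<le>N. p k * sin (real k * u)))\<^sup>2 = (\<phi> u)\<^sup>2
      - 2 * (\<Sum>k\<le>N. p k * (\<phi> u * sin (real k * u)))
      + (\<Sum>j\<le>N. \<Sum>k\<le>N. p j * p k * (sin (real j * u) * sin (real k * u)))" for u
    by (simp add: power2_eq_square algebra_simps sum_distrib_left sum_distrib_right)
  have 3: "(\<Sum>j\<le>N. \<Sum>k\<le>N. p j * p k * (if j = k \<and> k \<noteq> 0 then pi / 2 else 0))
      = pi / 2 * (\<Sum>k\<in>{1..N}. (p k)\<^sup>2)"
  proof -
    have "(\<Sum>k\<le>N. p j * p k * (if j = k \<and> k \<noteq> 0 then pi / 2 else 0)) =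
        (if j = 0 then 0 else pi / 2 * (p j)\<^sup>2)" if "j \<le> N" for j
    proof -
      have "(\<Sum>k\<le>N. p j * p k * (if j = k \<and> k \<noteq> 0 then pi / 2 else 0)) =
        (\<Sum>k\<le>N. if j = k then (if j = 0 then 0 else pi / 2 * (p j)\<^sup>2) else 0)"
        by (intro sum.cong) (auto simp: power2_eq_square)
      then show ?thesis using that by simp
    qed
    then have "(\<Sum>j\<le>N. \<Sum>k\<le>N. p j * p k * (if j = k \<and> k \<noteq> 0 then pi / 2 else 0))
        = (\<Sum>j\<le>N. (if j = 0 then 0 else pi / 2 * (p j)\<^sup>2))"
      by (intro sum.cong) auto
    also have "\<dots> = (\<Sum>j\<in>{1..N}. pi / 2 * (p j)\<^sup>2)"
      by (intro sum.mono_neutral_cong_right) auto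
    finally show ?thesis by (simp add: sum_distrib_left)
  qed
  show "((\<lambda>u. (\<phi> u - (\<Sum>k\<le>N. p k * sin (real k * u)))\<^sup>2) has_integral
     (integral {0..pi} (\<lambda>u. (\<phi> u)\<^sup>2) - 2 * (\<Sum>k\<le>N. p k * sine_coeff \<phi> k)
      + pi / 2 * (\<Sum>k\<in>{1..N}. (p k)\<^sup>2))) {0..pi}"
    unfolding eq 3[symmetric]
    by (intro has_integral_add has_integral_diff has_integral_mult_right has_integral_sum 1 2
        has_integral_sin_sin finite_atMost)
qed

lemma sine_coeff_0 [simp]: "sine_coeff \<phi> 0 = 0"
  by (simp add: sine_coeff_def)

lemma sum_atMost_sine_coeff:
  "(\<Sum>k\<le>N. c * sine_coeff \<phi> k * sine_coeff \<phi> k) = c * (\<Sum>k\<in>{1..N}. (sine_coeff \<phi> k)\<^sup>2)"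
proof -
  have "(\<Sum>k\<le>N. c * sine_coeff \<phi> k * sine_coeff \<phi> k) =
      (\<Sum>k\<in>{1..N}. c * sine_coeff \<phi> k * sine_coeff \<phi> k)"
  proof (rule sum.mono_neutral_right)
    show "\<forall>i\<in>{..N} - {1..N}. c * sine_coeff \<phi> i * sine_coeff \<phi> i = 0"
      by (auto simp: not_less_eq_eq)
  qed auto
  then show ?thesis by (simp add: power2_eq_square sum_distrib_left mult.assoc)
qed

lemma integral_sq_diff_sine_partial_sum:
  assumes "continuous_on {0..pi} \<phi>"
  shows "integral {0..pi} (\<lambda>u. (\<phi> u - (\<Sum>k\<le>N. 2 / pi * sine_coeff \<phi> k * sin (real k * u)))\<^sup>2) =
    integral {0..pi} (\<lambda>u. (\<phi> u)\<^sup>2) - 2 / pi * (\<Sum>k\<in>{1..N}. (sine_coeff \<phi> k)\<^sup>2)"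
proof -
  have "(\<Sum>k\<in>{1..N}. (2 / pi * sine_coeff \<phi> k)\<^sup>2) = (2 / pi)\<^sup>2 * (\<Sum>k\<in>{1..N}. (sine_coeff \<phi> k)\<^sup>2)"
    unfolding sum_distrib_left power_mult_distrib ..
  then show ?thesis
    unfolding integral_sq_diff_sine_sum[OF assms] sum_atMost_sine_coeff
    by (simp add: power2_eq_square field_simps)
qed

lemma sine_partial_sum_best_approximation:
  assumes "continuous_on {0..pi} \<phi>"
  shows "integral {0..pi} (\<lambda>u. (\<phi> u - (\<Sum>k\<le>N. 2 / pi * sine_coeff \<phi> k * sin (real k * u)))\<^sup>2)
    \<le> integral {0..pi} (\<lambda>u. (\<phi> u - (\<Sum>k\<le>N. p k * sin (real k * u)))\<^sup>2)"
proof -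
  have "0 \<le> (\<Sum>k\<in>{1..N}. pi / 2 * (p k - 2 / pi * sine_coeff \<phi> k)\<^sup>2)"
    by (intro sum_nonneg) auto
  also have "\<dots> = pi / 2 * (\<Sum>k\<in>{1..N}. (p k)\<^sup>2) - 2 * (\<Sum>k\<in>{1..N}. p k * sine_coeff \<phi> k)
      + 2 / pi * (\<Sum>k\<in>{1..N}. (sine_coeff \<phi> k)\<^sup>2)"
  proof -
    have "pi / 2 * (p k - 2 / pi * sine_coeff \<phi> k)\<^sup>2 =
        pi / 2 * (p k)\<^sup>2 - 2 * (p k * sine_coeff \<phi> k) + 2 / pi * (sine_coeff \<phi> k)\<^sup>2" for k
      by (simp add: power2_eq_square field_simps)
    then show ?thesis by (simp only: sum.distrib sum_subtractf sum_distrib_left)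
  qed
  also have "(\<Sum>k\<in>{1..N}. p k * sine_coeff \<phi> k) = (\<Sum>k\<le>N. p k * sine_coeff \<phi> k)"
  proof (rule sum.mono_neutral_left)
    show "\<forall>i\<in>{..N} - {1..N}. p i * sine_coeff \<phi> i = 0" by (auto simp: not_less_eq_eq)
  qed auto
  finally show ?thesis
    unfolding integral_sq_diff_sine_partial_sum[OF assms] integral_sq_diff_sine_sum[OF assms, where p = p]
    by simp
qed

lemma sine_bessel:
  assumes "continuous_on {0..pi} \<phi>"
  shows "summable (\<lambda>n. (sine_coeff \<phi> (Suc n))\<^sup>2)"
proof (rule bounded_imp_summable)
  fix n
  have "0 \<le> integral {0..pi} (\<lambda>u. (\<phi> u - (\<Sum>k\<le>Suc n. 2 / pi * sine_coeff \<phi> k * sin (real k * u)))\<^sup>2)"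
    by (intro integral_nonneg integrable_continuous_real continuous_intros assms) auto
  then have "(\<Sum>k\<in>{1..Suc n}. (sine_coeff \<phi> k)\<^sup>2) \<le> pi / 2 * integral {0..pi} (\<lambda>u. (\<phi> u)\<^sup>2)"
    unfolding integral_sq_diff_sine_partial_sum[OF assms] by (simp add: field_simps)
  moreover have "(\<Sum>k\<in>{1..Suc n}. (sine_coeff \<phi> k)\<^sup>2) = (\<Sum>k\<le>n. (sine_coeff \<phi> (Suc k))\<^sup>2)"
    using sum.shift_bounds_cl_Suc_ivl[of "\<lambda>k. (sine_coeff \<phi> k)\<^sup>2" 0 n] by (simp add: atLeast0AtMost)
  ultimately show "(\<Sum>k\<le>n. (sine_coeff \<phi> (Suc k))\<^sup>2) \<le> pi / 2 * integral {0..pi} (\<lambda>u. (\<phi> u)\<^sup>2)"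
    by simp
qed auto

text \<open>
  Finite linear combinations of the functions \<open>sin (n * u)\<close>. The inductive form makes closure under
  multiplication by \<open>cos u\<close> an easy induction.
\<close>

inductive sine_polynomial :: "(real \<Rightarrow> real) \<Rightarrow> bool" where
  sine: "sine_polynomial (\<lambda>u. sin (real n * u))"
| add: "sine_polynomial F \<Longrightarrow> sine_polynomial G \<Longrightarrow> sine_polynomial (\<lambda>u. F u + G u)"
| scale: "sine_polynomial F \<Longrightarrow> sine_polynomial (\<lambda>u. c * F u)"

lemma sine_polynomial_times_cos:
  "sine_polynomial F \<Longrightarrow> sine_polynomial (\<lambda>u. cos u * F u)"
proof (induction rule: sine_polynomial.induct)
  case (sine n)
  show ?case
  proof (cases n)
    case 0
    then show ?thesis using sine_polynomial.sine[of 0] by simp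
  next
    case (Suc m)
    have "(\<lambda>u. cos u * sin (real n * u)) = (\<lambda>u. 1 / 2 * (sin (real (m + 2) * u) + sin (real m * u)))"
    proof
      fix u :: real
      have "cos u * sin (real n * u) = (sin (real n * u + u) + sin (real n * u - u)) / 2"
        by (simp add: sin_add sin_diff)
      also have "real n * u + u = real (m + 2) * u"
        using Suc by (simp add: algebra_simps)
      also have "real n * u - u = real m * u"
        using Suc by (simp add: algebra_simps)
      finally show "cos u * sin (real n * u) = 1 / 2 * (sin (real (m + 2) * u) + sin (real m * u))"
        by simp
    qed
    then show ?thesis
      by (metis sine_polynomial.add sine_polynomial.scale sine_polynomial.sine)
  qed
next
  case (add F G)
  then show ?case using sine_polynomial.add by (simp add: distrib_left)
next
  case (scale F c)
  then show ?case using sine_polynomial.scale[OF scale.IH, of c] by (simp add: mult_ac)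
qed

text \<open>
  The expansion holds for all large \<open>M\<close>, so that two expansions can be added after padding both to a
  common length.
\<close>

lemma sine_polynomial_expansion:
  "sine_polynomial F \<Longrightarrow> \<exists>N p. \<forall>M\<ge>N. \<forall>u. F u = (\<Sum>k\<le>M. p k * sin (real k * u))"
proof (induction rule: sine_polynomial.induct)
  case (sine n)
  have "\<forall>M\<ge>n. \<forall>u. sin (real n * u) = (\<Sum>k\<le>M. (if k = n then 1 else 0) * sin (real k * u))"
    by (auto simp: if_distrib[of "\<lambda>x. x * _"] cong: if_cong)
  then show ?case by (intro exI)
next
  case (add F G)
  obtain N p where F: "\<forall>M\<ge>N. \<forall>u. F u = (\<Sum>k\<le>M. p k * sin (real k * u))"
    using add.IH(1) by blast
  obtain N' p' where G: "\<forall>M\<ge>N'. \<forall>u. G u = (\<Sum>k\<le>M. p' k * sin (real k * u))"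
    using add.IH(2) by blast
  from F G have "\<forall>M\<ge>max N N'. \<forall>u. F u + G u = (\<Sum>k\<le>M. (p k + p' k) * sin (real k * u))"
    by (auto simp: distrib_right sum.distrib intro!: arg_cong2[where f = "(+)"])
  then show ?case by (intro exI)
next
  case (scale F c)
  then obtain N p where "\<forall>M\<ge>N. \<forall>u. F u = (\<Sum>k\<le>M. p k * sin (real k * u))" by blast
  then have "\<forall>M\<ge>N. \<forall>u. c * F u = (\<Sum>k\<le>M. (c * p k) * sin (real k * u))"
    by (auto simp: mult.assoc simp flip: sum_distrib_left)
  then show ?case by (intro exI)
qed

lemma sine_polynomial_sum:
  assumes "\<And>i. i \<in> A \<Longrightarrow> sine_polynomial (F i)" "finite A"
  shows "sine_polynomial (\<lambda>u. \<Sum>i\<in>A. F i u)"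
  using assms(2,1)
proof (induction A)
  case empty
  show ?case using sine_polynomial.sine[of 0] by simp
next
  case (insert x A)
  then show ?case by (auto intro!: sine_polynomial.add)
qed

lemma sine_polynomial_sin_poly_cos:
  assumes "real_polynomial_function P"
  shows "sine_polynomial (\<lambda>u. sin u * P (cos u))"
proof -
  obtain a n where P: "P = (\<lambda>x. \<Sum>i\<le>n. a i * x ^ i)"
    using assms real_polynomial_function_iff_sum by blast
  have *: "sine_polynomial (\<lambda>u. sin u * cos u ^ i)" for i
  proof (induction i)
    case 0
    show ?case using sine_polynomial.sine[of 1] by simp
  next
    case (Suc i)
    show ?case using sine_polynomial_times_cos[OF Suc] by (simp add: mult_ac)
  qed
  have "sine_polynomial (\<lambda>u. \<Sum>i\<le>n. a i * (sin u * cos u ^ i))"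
    by (intro sine_polynomial_sum sine_polynomial.scale *) auto
  then show ?thesis unfolding P by (simp add: sum_distrib_left mult_ac)
qed

lemma continuous_on_sine_polynomial:
  "sine_polynomial F \<Longrightarrow> continuous_on A F"
  by (induction rule: sine_polynomial.induct) (auto intro!: continuous_intros)

text \<open>
  A function \<open>sin u * P (cos u)\<close> vanishes at both ends of the interval, whereas \<open>\<phi>\<close> need not. Dividing by
  \<open>sin u + 1 / (k + 1)\<close> instead of \<open>sin u\<close> keeps the quotient continuous, and the resulting error
  tends to 0 in mean square by dominated convergence.
\<close>

lemma tendsto_integral_damped:
  assumes "continuous_on {0..pi} \<phi>"
  shows "(\<lambda>k. integral {0..pi} (\<lambda>u. (\<phi> u - sin u * (\<phi> u / (sin u + 1 / real (Suc k))))\<^sup>2)) \<longlonglongrightarrow> 0"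
proof -
  define h where "h = (\<lambda>k u. (\<phi> u - sin u * (\<phi> u / (sin u + 1 / real (Suc k))))\<^sup>2)"
  have pos: "sin u + 1 / real (Suc k) > 0" if "u \<in> {0..pi}" for k u
    using that sin_ge_zero[of u] by (auto intro: add_nonneg_pos)
  have cont: "continuous_on {0..pi} (h k)" for k
    unfolding h_def using pos[of _ k] by (intro continuous_intros assms) force
  have int: "h k integrable_on {0<..<pi}" for k
    using integrable_continuous_real[OF cont[of k]] by (simp add: integrable_on_Icc_iff_Ioo)
  have form: "h k u = (\<phi> u)\<^sup>2 * ((1 / real (Suc k)) / (sin u + 1 / real (Suc k)))\<^sup>2"
    if "u \<in> {0..pi}" for k u
  proof -
    have "\<phi> u - sin u * (\<phi> u / (sin u + 1 / real (Suc k))) =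
        \<phi> u * ((1 / real (Suc k)) / (sin u + 1 / real (Suc k)))"
      using pos[OF that, of k] by (simp add: divide_simps) (simp add: algebra_simps)
    then show ?thesis unfolding h_def by (simp only: power_mult_distrib)
  qed
  have "(\<lambda>k. integral {0<..<pi} (h k)) \<longlonglongrightarrow> integral {0<..<pi} (\<lambda>u. 0)"
  proof (rule dominated_convergence(2)[OF int])
    show "(\<lambda>u. (\<phi> u)\<^sup>2) integrable_on {0<..<pi}"
      using integrable_continuous_real[of 0 pi "\<lambda>u. (\<phi> u)\<^sup>2"] assms
      by (auto intro!: continuous_intros simp: integrable_on_Icc_iff_Ioo)
    show "norm (h k u) \<le> (\<phi> u)\<^sup>2" if "u \<in> {0<..<pi}" for k u
    proof -
      have u: "u \<in> {0..pi}" using that by auto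
      have "(1 / real (Suc k)) / (sin u + 1 / real (Suc k)) \<le> 1"
        using pos[OF u, of k] sin_ge_zero[of u] u by (subst divide_le_eq_1_pos) auto
      then have "((1 / real (Suc k)) / (sin u + 1 / real (Suc k)))\<^sup>2 \<le> 1"
        using pos[OF u, of k] by (intro power_le_one) (auto intro!: divide_nonneg_nonneg)
      then have "h k u \<le> (\<phi> u)\<^sup>2 * 1" unfolding form[OF u] by (intro mult_left_mono) auto
      then show ?thesis by (simp add: h_def)
    qed
    show "(\<lambda>k. h k u) \<longlonglongrightarrow> 0" if "u \<in> {0<..<pi}" for u
    proof -
      have s: "sin u > 0" using that by (simp add: sin_gt_zero)
      have "(\<lambda>k. (\<phi> u)\<^sup>2 * ((1 / real (Suc k)) / (sin u + 1 / real (Suc k)))\<^sup>2)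
          \<longlonglongrightarrow> (\<phi> u)\<^sup>2 * (0 / (sin u + 0))\<^sup>2"
        using s by (intro tendsto_intros LIMSEQ_Suc[OF lim_inverse_n'] ) auto
      then show ?thesis using that by (simp add: form)
    qed
  qed
  then show ?thesis unfolding h_def by (simp add: integral_open_interval_real)
qed

text \<open>
  Sine polynomials are dense in mean square: the damped quotient is a continuous function of
  \<open>x = cos u\<close>, so Weierstrass' theorem approximates it by a polynomial \<open>P\<close>.
\<close>

lemma sine_polynomial_dense:
  assumes "continuous_on {0..pi} \<phi>" "e > 0"
  shows "\<exists>F. sine_polynomial F \<and> integral {0..pi} (\<lambda>u. (\<phi> u - F u)\<^sup>2) < e"
proof -
  \<comment> \<open>the damping and the polynomial approximation each contribute at most half of \<open>e\<close>\<close>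
  have "eventually (\<lambda>k. integral {0..pi} (\<lambda>u. (\<phi> u - sin u * (\<phi> u / (sin u + 1 / real (Suc k))))\<^sup>2) < e / 4) sequentially"
    using order_tendstoD(2)[OF tendsto_integral_damped[OF assms(1)], of "e / 4"] assms(2) by simp
  then obtain k where k: "integral {0..pi} (\<lambda>u. (\<phi> u - sin u * (\<phi> u / (sin u + 1 / real (Suc k))))\<^sup>2) < e / 4"
    by (auto simp: eventually_sequentially)
  define q where "q = (\<lambda>u. \<phi> u / (sin u + 1 / real (Suc k)))"
  have pos: "sin u + 1 / real (Suc k) > 0" if "u \<in> {0..pi}" for u
    using that sin_ge_zero[of u] by (auto intro: add_nonneg_pos)
  have q: "continuous_on {0..pi} q"
    unfolding q_def using pos by (intro continuous_intros assms) force
  define d where "d = sqrt (e / (4 * pi))"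
  have d: "d > 0" using assms(2) by (simp add: d_def)
  have "continuous_on {-1..1} (\<lambda>x. q (arccos x))"
    by (intro continuous_on_compose2[OF q] continuous_on_arccos' ) (auto simp: arccos_lbound arccos_ubound)
  then obtain P where P: "real_polynomial_function P" "\<And>x. x \<in> {-1..1} \<Longrightarrow> \<bar>q (arccos x) - P x\<bar> < d"
    using Stone_Weierstrass_real_polynomial_function[of "{-1..1}" "\<lambda>x. q (arccos x)" d] d by auto
  define F where "F = (\<lambda>u. sin u * P (cos u))"
  have F: "sine_polynomial F" unfolding F_def by (rule sine_polynomial_sin_poly_cos[OF P(1)])
  note cF = continuous_on_sine_polynomial[OF F]
  have bound: "(\<phi> u - F u)\<^sup>2 \<le> 2 * (\<phi> u - sin u * q u)\<^sup>2 + 2 * d\<^sup>2" if "u \<in> {0..pi}" for u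
  proof -
    have "\<bar>q u - P (cos u)\<bar> < d" using P(2)[of "cos u"] that by (simp add: arccos_cos)
    then have "\<bar>sin u * q u - F u\<bar> \<le> 1 * d"
      unfolding F_def right_diff_distrib[symmetric] abs_mult by (intro mult_mono) auto
    then have "(sin u * q u - F u)\<^sup>2 \<le> d\<^sup>2" by (simp add: abs_le_square_iff[symmetric] d less_imp_le)
    moreover have "(\<phi> u - F u)\<^sup>2 \<le> 2 * (\<phi> u - sin u * q u)\<^sup>2 + 2 * (sin u * q u - F u)\<^sup>2"
      using zero_le_power2[of "(\<phi> u - sin u * q u) - (sin u * q u - F u)"]
      by (simp add: power2_eq_square algebra_simps)
    ultimately show ?thesis by linarith
  qed
  have "integral {0..pi} (\<lambda>u. (\<phi> u - F u)\<^sup>2) \<le> integral {0..pi} (\<lambda>u. 2 * (\<phi> u - sin u * q u)\<^sup>2 + 2 * d\<^sup>2)"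
    by (intro integral_le integrable_continuous_real continuous_intros assms cF q bound) auto
  also have "\<dots> = integral {0..pi} (\<lambda>u. 2 * (\<phi> u - sin u * q u)\<^sup>2) + integral {0..pi} (\<lambda>u. 2 * d\<^sup>2)"
    by (intro integral_add integrable_continuous_real continuous_intros assms q)
  also have "\<dots> < 2 * (e / 4) + 2 * d\<^sup>2 * pi"
    using k by (simp add: q_def)
  also have "2 * d\<^sup>2 * pi = e / 2" unfolding d_def using assms(2) by simp
  finally show ?thesis using F by auto
qed

theorem sine_parseval:
  assumes \<phi>: "continuous_on {0..pi} \<phi>" and g: "continuous_on {0..pi} g"
  shows "(\<lambda>n. sine_coeff \<phi> (Suc n) * sine_coeff g (Suc n)) sums
           (pi / 2 * integral {0..pi} (\<lambda>u. \<phi> u * g u))"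
proof -
  define S where "S = (\<lambda>N u. \<Sum>k\<le>N. 2 / pi * sine_coeff \<phi> k * sin (real k * u))"
  have cS: "continuous_on {0..pi} (S N)" for N
    unfolding S_def by (intro continuous_intros)
  obtain B where B: "B > 0" "\<And>u. u \<in> {0..pi} \<Longrightarrow> \<bar>g u\<bar> \<le> B"
    using compact_imp_bounded[OF compact_continuous_image[OF g compact_Icc]]
    by (auto simp: bounded_pos)
  have lim: "(\<lambda>N. integral {0..pi} (\<lambda>u. (\<phi> u - S N u) * g u)) \<longlonglongrightarrow> 0"
  proof (rule LIMSEQ_I)
    fix e :: real assume e: "e > 0"
    \<comment> \<open>the weight \<open>\<eta>\<close> balances the two terms of the inequality between arithmetic and geometric means\<close>
    define \<eta> where "\<eta> = e / (2 * B * pi)"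
    have \<eta>: "\<eta> > 0" using e B by (simp add: \<eta>_def)
    obtain F where F: "sine_polynomial F" "integral {0..pi} (\<lambda>u. (\<phi> u - F u)\<^sup>2) < \<eta> * e / B"
      using sine_polynomial_dense[OF \<phi>, of "\<eta> * e / B"] \<eta> e B by auto
    obtain N p where N: "\<And>M u. M \<ge> N \<Longrightarrow> F u = (\<Sum>k\<le>M. p k * sin (real k * u))"
      using sine_polynomial_expansion[OF F(1)] by metis
    have "norm (integral {0..pi} (\<lambda>u. (\<phi> u - S M u) * g u) - 0) < e" if M: "M \<ge> N" for M
    proof -
      have sq: "integral {0..pi} (\<lambda>u. (\<phi> u - S M u)\<^sup>2) < \<eta> * e / B"
        using sine_partial_sum_best_approximation[OF \<phi>, of M p] F(2) N[OF M] by (simp add: S_def)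
      have "norm (integral {0..pi} (\<lambda>u. (\<phi> u - S M u) * g u))
          \<le> integral {0..pi} (\<lambda>u. B / 2 * (\<eta> + (\<phi> u - S M u)\<^sup>2 / \<eta>))"
      proof (rule integral_norm_bound_integral)
        fix u assume u: "u \<in> {0..pi}"
        have "2 * \<bar>\<phi> u - S M u\<bar> * \<eta> \<le> \<eta>\<^sup>2 + (\<phi> u - S M u)\<^sup>2"
          using zero_le_power2[of "\<bar>\<phi> u - S M u\<bar> - \<eta>"] by (simp add: power2_diff mult_ac)
        then have "\<bar>\<phi> u - S M u\<bar> \<le> 1 / 2 * (\<eta> + (\<phi> u - S M u)\<^sup>2 / \<eta>)"
          using \<eta> by (simp add: field_simps power2_eq_square)
        then have "\<bar>\<phi> u - S M u\<bar> * \<bar>g u\<bar> \<le> 1 / 2 * (\<eta> + (\<phi> u - S M u)\<^sup>2 / \<eta>) * B"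
          using B(2)[OF u] \<eta> by (intro mult_mono) auto
        then show "norm ((\<phi> u - S M u) * g u) \<le> B / 2 * (\<eta> + (\<phi> u - S M u)\<^sup>2 / \<eta>)"
          by (simp add: abs_mult mult_ac)
      qed (intro integrable_continuous_real continuous_intros \<phi> g cS; use \<eta> in simp)+
      also have "\<dots> = B / 2 * (integral {0..pi} (\<lambda>u. \<eta>) + integral {0..pi} (\<lambda>u. (\<phi> u - S M u)\<^sup>2 / \<eta>))"
        by (subst integral_mult_right, subst integral_add)
           (intro integrable_continuous_real continuous_intros \<phi> cS refl; use \<eta> in simp)+
      also have "\<dots> = B / 2 * (\<eta> * pi + integral {0..pi} (\<lambda>u. (\<phi> u - S M u)\<^sup>2) / \<eta>)"
        by simp
      also have "\<dots> < B / 2 * (\<eta> * pi + (\<eta> * e / B) / \<eta>)"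
        using sq \<eta> B by (intro mult_strict_left_mono add_strict_left_mono divide_strict_right_mono) auto
      also have "\<dots> < e" using \<eta> B e by (simp add: \<eta>_def field_simps)
      finally show ?thesis by simp
    qed
    then show "\<exists>no. \<forall>n\<ge>no. norm (integral {0..pi} (\<lambda>u. (\<phi> u - S n u) * g u) - 0) < e" by blast
  qed
  have eq: "integral {0..pi} (\<lambda>u. (\<phi> u - S N u) * g u) = integral {0..pi} (\<lambda>u. \<phi> u * g u)
      - 2 / pi * (\<Sum>k<N. sine_coeff \<phi> (Suc k) * sine_coeff g (Suc k))" for N
  proof -
    have "((\<lambda>u. \<phi> u * g u - (\<Sum>k\<le>N. 2 / pi * sine_coeff \<phi> k * (g u * sin (real k * u)))) has_integral
        (integral {0..pi} (\<lambda>u. \<phi> u * g u) - (\<Sum>k\<le>N. 2 / pi * sine_coeff \<phi> k * sine_coeff g k))) {0..pi}"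
      unfolding sine_coeff_def[of g]
      by (intro has_integral_diff has_integral_sum has_integral_mult_right integrable_integral
          integrable_continuous_real continuous_intros \<phi> g) auto
    moreover have "(\<phi> u - S N u) * g u = \<phi> u * g u - (\<Sum>k\<le>N. 2 / pi * sine_coeff \<phi> k * (g u * sin (real k * u)))" for u
      unfolding S_def left_diff_distrib sum_distrib_right by (simp only: mult_ac)
    ultimately have "integral {0..pi} (\<lambda>u. (\<phi> u - S N u) * g u) =
        integral {0..pi} (\<lambda>u. \<phi> u * g u) - (\<Sum>k\<le>N. 2 / pi * sine_coeff \<phi> k * sine_coeff g k)"
      by (simp add: integral_unique)
    also have "(\<Sum>k\<le>N. 2 / pi * sine_coeff \<phi> k * sine_coeff g k) =
        2 / pi * (\<Sum>k<N. sine_coeff \<phi> (Suc k) * sine_coeff g (Suc k))"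
      by (simp add: sum.atMost_shift sum_distrib_left mult.assoc)
    finally show ?thesis .
  qed
  have eq': "pi / 2 * (I - (I - 2 / pi * T)) = T" for I T :: real
    by (simp add: field_simps)
  have "(\<lambda>N. pi / 2 * (integral {0..pi} (\<lambda>u. \<phi> u * g u) - integral {0..pi} (\<lambda>u. (\<phi> u - S N u) * g u)))
      \<longlonglongrightarrow> pi / 2 * (integral {0..pi} (\<lambda>u. \<phi> u * g u) - 0)"
    by (intro tendsto_intros lim)
  then show ?thesis unfolding sums_def eq eq' diff_zero .
qed

section \<open>The integral of a cosine over a sum of hyperbolic cosines\<close>

lemma cosh_Complex: "cosh (Complex x y) = Complex (cosh x * cos y) (sinh x * sin y)"
  by (simp add: complex_eq_iff cosh_def sinh_def Re_exp Im_exp algebra_simps)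

lemma sinh_Complex: "sinh (Complex x y) = Complex (sinh x * cos y) (cosh x * sin y)"
  by (simp add: complex_eq_iff cosh_def sinh_def Re_exp Im_exp algebra_simps)

text \<open>
  In the strip \<open>- pi < Im z < 3 * pi\<close> around the contour the denominator of the integrand has
  exactly two zeros.
\<close>

lemma cosh_add_eq_0_in_strip:
  fixes u :: real and z :: complex
  assumes "u > 0" "- pi < Im z" "Im z < 3 * pi"
  shows "of_real (cosh u) + cosh z = 0 \<longleftrightarrow> z = Complex u pi \<or> z = Complex (- u) pi"
proof
  assume eq: "of_real (cosh u) + cosh z = 0"
  obtain x y where z: "z = Complex x y" by (cases z)
  have re: "cosh u + cosh x * cos y = 0" and im: "sinh x * sin y = 0"
    using eq by (auto simp: z cosh_Complex complex_eq_iff)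
  have "x \<noteq> 0"
  proof
    assume "x = 0"
    then have "cosh u \<le> 1" using re cos_ge_minus_one[of y] by (simp del: cos_ge_minus_one)
    moreover have "cosh u > 1" using assms(1) cosh_real_strict_mono[of 0 u] by simp
    ultimately show False by simp
  qed
  then have "sin y = 0" using im by simp
  have "cos y < 0"
    using re cosh_real_pos[of u] cosh_real_pos[of x]
    by (metis add_pos_nonneg less_irrefl linorder_not_less mult_nonneg_nonneg order_less_imp_le)
  have "(cos y)\<^sup>2 = 1" using \<open>sin y = 0\<close> sin_cos_squared_add[of y] by simp
  then have c: "cos y = - 1" using \<open>cos y < 0\<close> by (auto simp: power2_eq_1_iff)
  then obtain k :: int where k: "y = of_int k * 2 * pi + pi"
    unfolding cos_eq_minus1 by (auto simp: algebra_simps)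
  have "k = 0" 
  proof -
    have y: "- pi < y" "y < 3 * pi" using assms by (simp_all add: z)
    have "real_of_int k * pi < 1 * pi" "- 1 * pi < real_of_int k * pi"
      using k y by linarith+
    then have "real_of_int k < 1" "- 1 < real_of_int k"
      using pi_gt_zero mult_right_less_imp_less less_imp_le by blast+
    then show ?thesis by linarith
  qed
  then have "y = pi" using k by simp
  moreover have "cosh x = cosh u" using re c by simp
  then have "cosh \<bar>x\<bar> = cosh u" by simp
  then have "\<bar>x\<bar> = u"
    using assms(1) cosh_real_nonneg_less_iff[of "\<bar>x\<bar>" u] cosh_real_nonneg_less_iff[of u "\<bar>x\<bar>"] by simp
  ultimately show "z = Complex u pi \<or> z = Complex (- u) pi" by (auto simp: z)
next
  have "of_real (cosh u) + cosh (Complex s pi) = 0" if "s = u \<or> s = - u" for s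
    using that by (auto simp: cosh_Complex complex_eq_iff)
  then show "z = Complex u pi \<or> z = Complex (- u) pi \<Longrightarrow> of_real (cosh u) + cosh z = 0"
    by blast
qed

lemma norm_cosh_ge: "\<bar>sinh (Re z)\<bar> \<le> norm (cosh z)"
proof -
  obtain x y where z: "z = Complex x y" by (cases z)
  have "(norm (cosh z))\<^sup>2 = (cosh x)\<^sup>2 * (cos y)\<^sup>2 + (sinh x)\<^sup>2 * (sin y)\<^sup>2"
    by (simp add: z cosh_Complex cmod_power2 power_mult_distrib)
  also have "\<dots> = (sinh x)\<^sup>2 + (cos y)\<^sup>2"
    by (simp add: cosh_square_eq sin_squared_eq algebra_simps)
  finally have "(sinh x)\<^sup>2 \<le> (norm (cosh z))\<^sup>2" by simp
  then show ?thesis by (simp add: z abs_le_square_iff[symmetric])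
qed

lemma residue_exp_over_cosh:
  fixes u \<nu> s :: real
  assumes "u > 0" "s = u \<or> s = - u"
  shows "residue (\<lambda>z. exp (\<i> * of_real \<nu> * z) / (of_real (cosh u) + cosh z)) (Complex s pi) =
    - exp (- \<nu> * pi) * cis (\<nu> * s) / of_real (sinh s)"
proof -
  define S where "S = {z. - pi < Im z} \<inter> {z. Im z < 3 * pi} - {Complex (- s) pi}"
  have "open S" unfolding S_def
    by (intro open_Diff open_Int open_halfspace_Im_gt open_halfspace_Im_lt) auto
  have s: "s \<noteq> 0" using assms by auto
  have mem: "Complex s pi \<in> S" using s pi_gt_zero by (auto simp: S_def)
  have zero: "of_real (cosh u) + cosh (Complex s pi) = 0"
    using assms by (auto simp: cosh_Complex complex_eq_iff)
  have nz: "of_real (cosh u) + cosh z \<noteq> (0::complex)" if "z \<in> S - {Complex s pi}" for z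
    using that cosh_add_eq_0_in_strip[OF assms(1), of z] assms(2) by (auto simp: S_def)
  have D: "((\<lambda>z. of_real (cosh u) + cosh z) has_field_derivative sinh (Complex s pi)) (at (Complex s pi))"
    by (auto intro!: derivative_eq_intros)
  have lim: "((\<lambda>w. (of_real (cosh u) + cosh w) / (w - Complex s pi)) \<longlongrightarrow> sinh (Complex s pi)) (at (Complex s pi))"
    using D unfolding has_field_derivative_iff zero by simp
  have sinh: "sinh (Complex s pi) = - of_real (sinh s)"
    by (simp add: sinh_Complex complex_eq_iff)
  have "((\<lambda>w. exp (\<i> * of_real \<nu> * w) / ((of_real (cosh u) + cosh w) / (w - Complex s pi))) \<longlongrightarrow>
      exp (\<i> * of_real \<nu> * Complex s pi) / sinh (Complex s pi)) (at (Complex s pi))"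
    using s by (intro tendsto_divide lim) (auto intro!: tendsto_intros simp: sinh)
  moreover have "exp (\<i> * of_real \<nu> * Complex s pi) = exp (- \<nu> * pi) * cis (\<nu> * s)"
    by (simp add: Complex_eq cis_conv_exp algebra_simps exp_add exp_of_real[symmetric]
        flip: exp_of_real of_real_minus of_real_mult)
  ultimately have lim2: "((\<lambda>w. exp (\<i> * of_real \<nu> * w) / (of_real (cosh u) + cosh w) * (w - Complex s pi)) \<longlongrightarrow>
      - exp (- \<nu> * pi) * cis (\<nu> * s) / of_real (sinh s)) (at (Complex s pi))"
    by (simp add: sinh)
  show ?thesis
    by (rule residue_simple'[OF \<open>open S\<close> mem _ lim2]) (use nz in \<open>auto intro!: holomorphic_intros simp: cosh_conv_cos\<close>)
qed

lemma contour_integral_linepath_same_Im: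
  assumes "Im z = y" "Im z' = y" "Re z = a" "Re z' = b" "a < b"
  shows "contour_integral (linepath z z') f = integral {a..b} (\<lambda>x. f (Complex x y))"
proof -
  have "z' - z = of_real b - of_real a"
    using assms by (simp add: complex_eq_iff)
  moreover have "linepath z z' t = linepath (of_real a) (of_real b) t + \<i> * of_real y" for t
    using assms by (simp add: linepath_def complex_eq_iff algebra_simps)
  ultimately have "contour_integral (linepath z z') f =
      contour_integral (linepath (of_real a) (of_real b)) (\<lambda>w. f (w + \<i> * of_real y))"
    by (simp add: contour_integral_integral)
  also have "\<dots> = integral {a..b} (\<lambda>x. f (of_real x + \<i> * of_real y))"
    using assms(5) by (subst contour_integral_linepath_Reals_eq) auto
  finally show ?thesis by (simp add: Complex_eq)
qed

lemma contour_integral_rectpath: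
  assumes f: "continuous_on (path_image (rectpath a b)) f" and ab: "Re a < Re b" "Im a < Im b"
  shows "contour_integral (rectpath a b) f =
    integral {Re a..Re b} (\<lambda>x. f (Complex x (Im a))) - integral {Re a..Re b} (\<lambda>x. f (Complex x (Im b)))
    + contour_integral (linepath (Complex (Re b) (Im a)) b) f
    + contour_integral (linepath (Complex (Re a) (Im b)) a) f"
proof -
  define c d where "c = Complex (Re b) (Im a)" and "d = Complex (Re a) (Im b)"
  have im: "path_image (rectpath a b) = closed_segment a c \<union> closed_segment c b \<union> closed_segment b d \<union> closed_segment d a"
    by (simp add: rectpath_def Let_def path_image_join c_def d_def Un_assoc)
  have int: "f contour_integrable_on (linepath a c)" "f contour_integrable_on (linepath c b)"
    "f contour_integrable_on (linepath b d)" "f contour_integrable_on (linepath d a)"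
    by (auto intro!: contour_integrable_continuous_linepath continuous_on_subset[OF f] simp: im)
  have "contour_integral (rectpath a b) f = contour_integral (linepath a c) f +
      contour_integral (linepath c b) f + contour_integral (linepath b d) f + contour_integral (linepath d a) f"
    using int by (simp add: rectpath_def Let_def flip: c_def d_def)
  also have "contour_integral (linepath a c) f = integral {Re a..Re b} (\<lambda>x. f (Complex x (Im a)))"
    by (rule contour_integral_linepath_same_Im) (use ab in \<open>auto simp: c_def\<close>)
  also have "contour_integral (linepath b d) f = - contour_integral (linepath d b) f"
    using f by (intro contour_integral_reverse_linepath continuous_on_subset[OF f]) (auto simp: im closed_segment_commute)
  also have "contour_integral (linepath d b) f = integral {Re a..Re b} (\<lambda>x. f (Complex x (Im b)))"
    by (rule contour_integral_linepath_same_Im) (use ab in \<open>auto simp: d_def\<close>)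
  finally show ?thesis by (simp add: c_def d_def)
qed

text \<open>
  Integrating around the rectangle with corners \<open>- T\<close> and \<open>T + 2 * pi * \<i>\<close>: the denominator has
  period \<open>2 * pi * \<i>\<close>, so the top side reproduces the bottom side up to the factor
  \<open>exp (- 2 * pi * \<nu>)\<close>. The right-hand side bounds the two vertical sides.
\<close>

lemma integral_exp_over_cosh_rectangle:
  fixes u \<nu> T :: real
  assumes "u > 0" "\<nu> > 0" "cosh u < sinh T" "u < T"
  shows "norm ((1 - exp (- 2 * pi * \<nu>)) * integral {-T..T} (\<lambda>x. cis (\<nu> * x) / of_real (cosh u + cosh x))
     - of_real (4 * pi * exp (- \<nu> * pi) * sin (\<nu> * u) / sinh u)) \<le> 4 * pi / (sinh T - cosh u)"
proof -
  define h where "h = (\<lambda>z. exp (\<i> * of_real \<nu> * z) / (of_real (cosh u) + cosh z))"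
  define S where "S = {z. - pi < Im z} \<inter> {z. Im z < 3 * pi}"
  define a b where "a = Complex (-T) 0" and "b = Complex T (2 * pi)"
  define g where "g = rectpath a b"
  define P where "P = {Complex u pi, Complex (-u) pi}"
  have T: "T > 0" using assms by simp
  have "open S" unfolding S_def
    by (intro open_Int open_halfspace_Im_gt open_halfspace_Im_lt)
  have "convex S" unfolding S_def
    by (intro convex_Int convex_halfspace_Im_gt convex_halfspace_Im_lt)
  then have "connected S" by (rule convex_connected)
  have nz: "of_real (cosh u) + cosh z \<noteq> (0::complex)" if "z \<in> S - P" for z
    using that cosh_add_eq_0_in_strip[OF assms(1), of z] by (auto simp: S_def P_def)
  have holo: "h holomorphic_on S - P"
    unfolding h_def using nz by (auto intro!: holomorphic_intros simp: cosh_conv_cos)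
  have cb: "cbox a b \<subseteq> S" 
    by (auto simp: in_cbox_complex_iff a_def b_def S_def) (use pi_gt_zero in linarith)+
  have Pb: "P \<subseteq> box a b" using assms pi_gt_zero by (auto simp: P_def a_def b_def in_box_complex_iff)
  have pim: "path_image g \<subseteq> S - P"
    using path_image_rectpath_cbox_minus_box[of a b] cb Pb T pi_gt_zero by (auto simp: g_def a_def b_def)
  have "contour_integral g h = 2 * pi * \<i> * (\<Sum>p\<in>P. winding_number g p * residue h p)"
  proof (rule Residue_theorem[OF \<open>open S\<close> \<open>connected S\<close> _ holo _ _ pim])
    show "\<forall>z. z \<notin> S \<longrightarrow> winding_number g z = 0"
      using cb T pi_gt_zero unfolding g_def
      by (intro allI impI winding_number_rectpath_outside) (auto simp: a_def b_def)
  qed (auto simp: P_def g_def)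
  also have "\<dots> = 2 * pi * \<i> * (\<Sum>p\<in>P. residue h p)"
    using Pb by (intro arg_cong2[where f = "(*)"] refl sum.cong) (auto simp: g_def winding_number_rectpath)
  also have "(\<Sum>p\<in>P. residue h p) = residue h (Complex u pi) + residue h (Complex (-u) pi)"
    using assms(1) by (simp add: P_def)
  also have "\<dots> = - exp (- \<nu> * pi) * (cis (\<nu> * u) - cis (- (\<nu> * u))) / of_real (sinh u)"
    using assms(1) unfolding h_def
    by (subst (1 2) residue_exp_over_cosh) (auto simp: diff_divide_distrib right_diff_distrib)
  also have "cis (\<nu> * u) - cis (- (\<nu> * u)) = 2 * \<i> * of_real (sin (\<nu> * u))"
    by (simp add: complex_eq_iff)
  also have "2 * pi * \<i> * (- exp (- \<nu> * pi) * (2 * \<i> * of_real (sin (\<nu> * u))) / of_real (sinh u)) =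
      of_real (4 * pi * exp (- \<nu> * pi) * sin (\<nu> * u) / sinh u)"
    by (simp add: complex_eq_iff)
  finally have ci: "contour_integral g h = of_real (4 * pi * exp (- \<nu> * pi) * sin (\<nu> * u) / sinh u)" .
  have cont: "continuous_on (path_image g) h"
    using holo pim holomorphic_on_imp_continuous_on continuous_on_subset by blast
  define I where "I = integral {-T..T} (\<lambda>x. cis (\<nu> * x) / of_real (cosh u + cosh x))"
  have bot: "h (Complex x 0) = cis (\<nu> * x) / of_real (cosh u + cosh x)" for x
  proof -
    have "cosh (Complex x 0) = of_real (cosh x)" by (simp add: cosh_Complex complex_eq_iff)
    then show ?thesis by (simp add: h_def cis_conv_exp Complex_eq mult_ac)
  qed
  have top: "h (Complex x (2 * pi)) = exp (- 2 * pi * \<nu>) * (cis (\<nu> * x) / of_real (cosh u + cosh x))" for x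
  proof -
    have "exp (\<i> * of_real \<nu> * Complex x (2 * pi)) = of_real (exp (- 2 * pi * \<nu>)) * cis (\<nu> * x)"
      unfolding cis_conv_exp exp_of_real[symmetric] exp_add[symmetric]
      by (simp add: Complex_eq algebra_simps)
    moreover have "cosh (Complex x (2 * pi)) = of_real (cosh x)"
      by (simp add: cosh_Complex complex_eq_iff)
    ultimately show ?thesis by (simp add: h_def)
  qed
  have "integral {-T..T} (\<lambda>x. h (Complex x 0)) = I"
    by (simp only: bot I_def)
  moreover have "integral {-T..T} (\<lambda>x. h (Complex x (2 * pi))) = exp (- 2 * pi * \<nu>) * I"
    unfolding top I_def by (rule integral_mult_right)
  moreover define R where "R = contour_integral (linepath (Complex T 0) b) h"
  moreover define L where "L = contour_integral (linepath (Complex (-T) (2 * pi)) a) h"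
  ultimately have "contour_integral g h = I - exp (- 2 * pi * \<nu>) * I + R + L"
    using contour_integral_rectpath[OF cont[unfolded g_def]] T pi_gt_zero
    by (simp add: g_def a_def b_def)
  then have eq: "(1 - exp (- 2 * pi * \<nu>)) * I - of_real (4 * pi * exp (- \<nu> * pi) * sin (\<nu> * u) / sinh u) = - (R + L)"
    unfolding ci by (simp add: algebra_simps)
  have hb: "norm (h z) \<le> 1 / (sinh T - cosh u)" if "\<bar>Re z\<bar> = T" "Im z \<ge> 0" for z
  proof -
    have "sinh T \<le> norm (cosh z)"
      using norm_cosh_ge[of z] that(1) T sinh_real_abs[of "Re z"] by simp
    moreover have "norm (cosh z) - cosh u \<le> norm (of_real (cosh u) + cosh z)"
      using norm_diff_ineq[of "cosh z" "of_real (cosh u)"] by (simp add: add.commute)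
    ultimately have "sinh T - cosh u \<le> norm (of_real (cosh u) + cosh z)" by linarith
    moreover have "norm (exp (\<i> * of_real \<nu> * z)) \<le> 1"
      using that assms by simp
    ultimately show ?thesis unfolding h_def norm_divide using assms by (intro frac_le) auto
  qed
  have seg: "closed_segment (Complex T 0) b \<subseteq> path_image g" "closed_segment (Complex (-T) (2 * pi)) a \<subseteq> path_image g"
    by (auto simp: g_def rectpath_def Let_def path_image_join a_def b_def)
  have "norm R \<le> 1 / (sinh T - cosh u) * norm (b - Complex T 0)" unfolding R_def
  proof (rule contour_integral_bound_linepath)
    show "h contour_integrable_on linepath (Complex T 0) b"
      using cont seg by (intro contour_integrable_continuous_linepath) (auto intro: continuous_on_subset)
    show "norm (h x) \<le> 1 / (sinh T - cosh u)" if "x \<in> closed_segment (Complex T 0) b" for x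
      using that T by (intro hb) (auto simp: b_def closed_segment_same_Re closed_segment_eq_real_ivl split: if_splits)
  qed (use assms in auto)
  moreover have "norm L \<le> 1 / (sinh T - cosh u) * norm (a - Complex (-T) (2 * pi))" unfolding L_def
  proof (rule contour_integral_bound_linepath)
    show "h contour_integrable_on linepath (Complex (-T) (2 * pi)) a"
      using cont seg by (intro contour_integrable_continuous_linepath) (auto intro: continuous_on_subset)
    show "norm (h x) \<le> 1 / (sinh T - cosh u)" if "x \<in> closed_segment (Complex (-T) (2 * pi)) a" for x
      using that T by (intro hb) (auto simp: a_def closed_segment_same_Re closed_segment_eq_real_ivl split: if_splits)
  qed (use assms in auto)
  moreover have "norm (b - Complex T 0) = 2 * pi" "norm (a - Complex (-T) (2 * pi)) = 2 * pi"
    by (auto simp: a_def b_def cmod_def real_sqrt_mult)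
  ultimately have "norm (R + L) \<le> 4 * pi / (sinh T - cosh u)"
    using norm_triangle_ineq[of R L] by simp
  then show ?thesis by (simp only: eq[unfolded I_def] norm_minus_cancel)
qed


lemma set_integral_exp_neg:
  fixes c :: real
  assumes "c > 0"
  shows "set_integrable lborel {0<..} (\<lambda>x. exp (- x * c))"
    and "(LBINT x:{0<..}. exp (- x * c)) = 1 / c"
proof -
  have e: "einterval 0 \<infinity> = {0<..}" by (auto simp: einterval_def)
  have D: "((\<lambda>x. - exp (- x * c) / c) has_real_derivative exp (- x * c)) (at x)" for x
    using assms by (auto intro!: derivative_eq_intros)
  have A: "(((\<lambda>x. - exp (- x * c) / c) \<circ> real_of_ereal) \<longlongrightarrow> - 1 / c) (at_right 0)"
    unfolding zero_ereal_def ereal_tendsto_simps1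
    using assms by (auto intro!: tendsto_eq_intros)
  have B: "(((\<lambda>x. - exp (- x * c) / c) \<circ> real_of_ereal) \<longlongrightarrow> 0) (at_left \<infinity>)"
  proof -
    have "filterlim (\<lambda>x. c * - x) at_bot at_top"
      using assms filterlim_tendsto_pos_mult_at_bot[OF tendsto_const _ filterlim_uminus_at_bot_at_top] by blast
    then have "((\<lambda>x. exp (- x * c)) \<longlongrightarrow> 0) at_top"
      using filterlim_compose[OF exp_at_bot] by (simp add: mult.commute)
    then have "((\<lambda>x. - exp (- x * c) / c) \<longlongrightarrow> - 0 / c) at_top"
      using assms by (intro tendsto_intros) auto
    then show ?thesis by (simp add: ereal_tendsto_simps1)
  qed
  have "set_integrable lborel (einterval 0 \<infinity>) (\<lambda>x. exp (- x * c))
     \<and> (LBINT x=0..\<infinity>. exp (- x * c)) = 0 - (- 1 / c)"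
    using interval_integral_FTC_nonneg[OF _ _ _ _ A B, of "\<lambda>x. exp (- x * c)"] D by auto
  then show "set_integrable lborel {0<..} (\<lambda>x. exp (- x * c))"
    and "(LBINT x:{0<..}. exp (- x * c)) = 1 / c"
    by (auto simp: e interval_lebesgue_integral_0_infty)
qed

lemma set_borel_measurable_continuous_on:
  fixes f :: "real \<Rightarrow> 'a::real_normed_vector"
  assumes "A \<in> sets borel" "continuous_on A f"
  shows "set_borel_measurable lborel A f"
  using borel_measurable_continuous_on_indicator[OF assms] by (simp add: set_borel_measurable_def)

lemma set_integrable_inverse_cosh_sum:
  fixes u :: real
  shows "set_integrable lborel {0<..} (\<lambda>v. 1 / (cosh u + cosh v))"
proof (rule set_integrable_bound)
  show "set_integrable lborel {0<..} (\<lambda>v. 2 * exp (- v * 1 :: real))"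
    using set_integral_exp_neg(1)[of 1] by simp
  show "set_borel_measurable lborel {0<..} (\<lambda>v. 1 / (cosh u + cosh v))"
    by (intro set_borel_measurable_continuous_on continuous_intros)
       (auto simp: add_pos_pos less_imp_neq[symmetric])
  have "norm (1 / (cosh u + cosh v)) \<le> norm (2 * exp (- v * 1))" for v :: real
  proof -
    have "exp v \<le> 2 * cosh v" by (simp add: cosh_def)
    also have "2 * cosh v \<le> 2 * (cosh u + cosh v)" using cosh_real_pos[of u] by simp
    finally have "exp v \<le> 2 * (cosh u + cosh v)" .
    then have "1 / (2 * (cosh u + cosh v)) \<le> 1 / exp v" by (intro divide_left_mono) (auto simp: add_pos_pos)
    then show ?thesis by (simp add: exp_minus field_simps add_pos_pos)
  qed
  then show "AE v in lborel. v \<in> {0<..} \<longrightarrow> norm (1 / (cosh u + cosh v)) \<le> norm (2 * exp (- v * 1))"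
    by simp
qed

lemma set_integrable_cos_over_cosh_sum:
  fixes u \<nu> :: real
  shows "set_integrable lborel {0<..} (\<lambda>v. cos (\<nu> * v) / (cosh u + cosh v))"
proof (rule set_integrable_bound[OF set_integrable_inverse_cosh_sum[of u]])
  show "set_borel_measurable lborel {0<..} (\<lambda>v. cos (\<nu> * v) / (cosh u + cosh v))"
    by (intro set_borel_measurable_continuous_on continuous_intros)
       (auto simp: add_pos_pos less_imp_neq[symmetric])
  show "AE v in lborel. v \<in> {0<..} \<longrightarrow> norm (cos (\<nu> * v) / (cosh u + cosh v)) \<le> norm (1 / (cosh u + cosh v))"
    by (auto simp: abs_div intro!: divide_right_mono)
qed

lemma integral_symmetric:
  fixes h :: "real \<Rightarrow> 'a::euclidean_space"
  assumes "continuous_on {-T..T} h" "T \<ge> 0"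
  shows "integral {-T..T} h = integral {0..T} (\<lambda>x. h x + h (- x))"
proof -
  have c: "continuous_on {-T..0} h" "continuous_on {0..T} h"
    using assms(2) by (auto intro: continuous_on_subset[OF assms(1)])
  have c': "continuous_on {0..T} (\<lambda>x. h (- x))"
    using assms(2) by (intro continuous_on_compose2[OF assms(1)] continuous_intros) auto
  have "integral {-T..T} h = integral {-T..0} h + integral {0..T} h"
    using assms by (intro Henstock_Kurzweil_Integration.integral_combine[symmetric] integrable_continuous_real) auto
  also have "integral {-T..0} h = integral {0..T} (\<lambda>x. h (- x))"
    using Henstock_Kurzweil_Integration.integral_reflect_real[of T 0 "\<lambda>x. h (- x)"] by simp
  finally show ?thesis
    using integral_add[OF integrable_continuous_real[OF c(2)] integrable_continuous_real[OF c']]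
    by (simp add: add.commute)
qed
text \<open>
  The integral that links the Kontorovich-Lebedev transform to sine coefficients; it is the limit
  \<open>T \<rightarrow> \<infinity>\<close> of the rectangle estimate.
\<close>

theorem integral_cos_over_cosh_sum:
  fixes u \<nu> :: real
  assumes "u > 0" "\<nu> > 0"
  shows "(LBINT v:{0<..}. cos (\<nu> * v) / (cosh u + cosh v)) = pi * sin (\<nu> * u) / (sinh u * sinh (\<nu> * pi))"
proof -
  define h where "h = (\<lambda>v. cos (\<nu> * v) / (cosh u + cosh v))"
  define J where "J = (LBINT v:{0<..}. h v)"
  define E where "E = exp (- 2 * pi * \<nu>)"
  have nz: "cosh u + cosh x \<noteq> 0" for x :: real
    using add_pos_pos[OF cosh_real_pos[of u] cosh_real_pos[of x]] by simp
  have h_even: "h x + h (- x) = 2 * h x" for x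
    by (simp add: h_def)
  have ch: "continuous_on A h" for A
    unfolding h_def by (intro continuous_intros) (use nz in auto)
  have "((\<lambda>T. LINT x|lborel. indicator {..T} x *\<^sub>R (indicator {0<..} x *\<^sub>R h x)) \<longlongrightarrow> J) at_top"
    unfolding J_def set_lebesgue_integral_def
    by (rule tendsto_integral_at_top)
       (use set_integrable_cos_over_cosh_sum[of \<nu> u] in \<open>auto simp: h_def set_integrable_def\<close>)
  moreover have "eventually (\<lambda>T. (LINT x|lborel. indicator {..T} x *\<^sub>R (indicator {0<..} x *\<^sub>R h x))
      = integral {0..T} h) at_top"
    using eventually_ge_at_top[of 0]
  proof eventually_elim
    case (elim T)
    have "(LINT x|lborel. indicator {..T} x *\<^sub>R (indicator {0<..} x *\<^sub>R h x)) = (LBINT x:{0<..T}. h x)"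
      unfolding set_lebesgue_integral_def
      by (intro Bochner_Integration.integral_cong) (auto simp: indicator_def)
    also have "\<dots> = (LBINT x=ereal 0..ereal T. h x)" using elim by (simp add: interval_integral_Ioc)
    also have "\<dots> = integral {0..T} h"
      using elim by (intro interval_integral_eq_integral borel_integrable_atLeastAtMost' ch)
    finally show ?case .
  qed
  ultimately have "((\<lambda>T. integral {0..T} h) \<longlongrightarrow> J) at_top"
    by (rule Lim_transform_eventually)
  then have lim1: "((\<lambda>T. (1 - E) * (2 * integral {0..T} h)) \<longlongrightarrow> (1 - E) * (2 * J)) at_top"
    by (intro tendsto_intros)
  define V where "V = 4 * pi * exp (- \<nu> * pi) * sin (\<nu> * u) / sinh u"
  have fin: "((\<lambda>T. 4 * pi / (sinh T - cosh u)) \<longlongrightarrow> 0) at_top"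
    using filterlim_tendsto_add_at_top[OF tendsto_const[of "- cosh u"] sinh_real_at_top]
    by (intro tendsto_divide_0[OF tendsto_const] filterlim_at_top_imp_at_infinity) simp
  have "((\<lambda>T. (1 - E) * (2 * integral {0..T} h) - V) \<longlongrightarrow> 0) at_top"
  proof (rule Lim_null_comparison[OF _ fin])
    have "eventually (\<lambda>T. cosh u < sinh T) at_top"
      using sinh_real_at_top by (simp add: filterlim_at_top_dense)
    then show "eventually (\<lambda>T. norm ((1 - E) * (2 * integral {0..T} h) - V) \<le> 4 * pi / (sinh T - cosh u)) at_top"
      using eventually_gt_at_top[of u]
    proof eventually_elim
      case (elim T)
      define I where "I = integral {-T..T} (\<lambda>x. cis (\<nu> * x) / of_real (cosh u + cosh x))"
      have "(\<lambda>x. cis (\<nu> * x) / of_real (cosh u + cosh x)) integrable_on {-T..T}"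
        unfolding cis_conv_exp
        by (intro integrable_continuous_real continuous_intros) (use nz in \<open>auto simp flip: of_real_add\<close>)
      then have "Re I = integral {-T..T} (Re \<circ> (\<lambda>x. cis (\<nu> * x) / of_real (cosh u + cosh x)))"
        unfolding I_def using integral_linear[OF _ bounded_linear_Re] by metis
      also have "Re \<circ> (\<lambda>x. cis (\<nu> * x) / of_real (cosh u + cosh x)) = h"
        by (simp add: h_def fun_eq_iff del: of_real_add)
      also have "integral {-T..T} h = 2 * integral {0..T} h"
        using elim assms integral_symmetric[OF ch, of T] by (simp add: h_even)
      finally have ReI: "Re I = 2 * integral {0..T} h" .
      have "norm (of_real (1 - E) * I - of_real V) \<le> 4 * pi / (sinh T - cosh u)"
        using integral_exp_over_cosh_rectangle[OF assms elim] by (simp add: I_def E_def V_def)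
      moreover have "\<bar>Re (of_real (1 - E) * I - of_real V)\<bar> \<le> norm (of_real (1 - E) * I - of_real V)"
        by (rule abs_Re_le_cmod)
      moreover have "Re (of_real (1 - E) * I - of_real V) = (1 - E) * (2 * integral {0..T} h) - V"
        unfolding ReI[symmetric] by simp
      ultimately show ?case by (simp only: real_norm_def order_trans)
    qed
  qed
  then have "((\<lambda>T. (1 - E) * (2 * integral {0..T} h)) \<longlongrightarrow> V) at_top"
    by (rule LIM_zero_cancel)
  then have "(1 - E) * (2 * J) = V"
    using tendsto_unique[OF _ lim1] by simp
  moreover have "1 - E = 2 * exp (- \<nu> * pi) * sinh (\<nu> * pi)"
    by (simp add: E_def sinh_def field_simps exp_minus) (simp add: power2_eq_square flip: exp_add exp_double)
  ultimately show ?thesis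
    using assms unfolding J_def h_def V_def by (simp add: field_simps)
qed

section \<open>The incomplete Bessel integral with imaginary index\<close>

text \<open>
  The \<open>k\<close>-th derivative in \<open>r\<close> of the incomplete Bessel integral \<open>J(r, i n, pi)\<close>, written as the real
  integral obtained by differentiating under the integral sign.
\<close>

definition J_deriv :: "nat \<Rightarrow> nat \<Rightarrow> real \<Rightarrow> real" where
  "J_deriv k n r = integral {0..pi} (\<lambda>u. (- cosh u) ^ k * exp (- r * cosh u) * cos (real n * u))"

lemma incomplete_J_eq:
  "incomplete_J (complex_of_real r) (\<i> * of_nat n) pi = complex_of_real (J_deriv 0 n r)"
proof -
  have eq: "exp (- complex_of_real r * complex_of_real (cosh u)) * cosh (\<i> * of_nat n * complex_of_real u) =
      complex_of_real (exp (- r * cosh u) * cos (real n * u))" for u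
  proof -
    have "cosh (\<i> * complex_of_real (real n * u)) = complex_of_real (cos (real n * u))"
      by (simp only: cos_conv_cosh[symmetric] cos_of_real)
    then have "cosh (\<i> * of_nat n * complex_of_real u) = complex_of_real (cos (real n * u))"
      by (simp add: mult.assoc)
    then show ?thesis by (simp add: exp_of_real[symmetric])
  qed
  have "incomplete_J (complex_of_real r) (\<i> * of_nat n) pi =
      complex_of_real (LBINT u=ereal 0..ereal pi. exp (- r * cosh u) * cos (real n * u))"
    unfolding incomplete_J_def eq interval_lebesgue_integral_of_real by (simp add: zero_ereal_def)
  also have "(LBINT u=ereal 0..ereal pi. exp (- r * cosh u) * cos (real n * u)) = J_deriv 0 n r"
    unfolding J_deriv_def
    by (subst interval_integral_eq_integral)
       (auto intro!: borel_integrable_atLeastAtMost' continuous_intros)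
  finally show ?thesis .
qed

lemma J_deriv_has_integral:
  "((\<lambda>u. (- cosh u) ^ k * exp (- r * cosh u) * cos (real n * u)) has_integral J_deriv k n r) {0..pi}"
  unfolding J_deriv_def by (intro integrable_integral integrable_continuous_real continuous_intros)

lemma has_field_derivative_J_deriv:
  "(J_deriv k n has_field_derivative J_deriv (Suc k) n r) (at r)"
proof -
  have "((\<lambda>r. integral (cbox 0 pi) (\<lambda>u. (- cosh u) ^ k * exp (- r * cosh u) * cos (real n * u)))
      has_field_derivative integral (cbox 0 pi)
        ((\<lambda>r u. (- cosh u) ^ Suc k * exp (- r * cosh u) * cos (real n * u)) r)) (at r within UNIV)"
  proof (rule leibniz_rule_field_derivative)
    show "((\<lambda>r. (- cosh u) ^ k * exp (- r * cosh u) * cos (real n * u)) has_field_derivative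
        (- cosh u) ^ Suc k * exp (- r * cosh u) * cos (real n * u)) (at r within UNIV)" for r u :: real
      by (auto intro!: derivative_eq_intros)
    show "(\<lambda>u. (- cosh u) ^ k * exp (- r * cosh u) * cos (real n * u)) integrable_on cbox 0 pi" for r :: real
      unfolding cbox_interval by (intro integrable_continuous_real continuous_intros)
    show "continuous_on (UNIV \<times> cbox 0 pi)
        (\<lambda>(r, u). (- cosh u) ^ Suc k * exp (- r * cosh u) * cos (real n * u))"
      unfolding case_prod_beta by (intro continuous_intros)
  qed auto
  then show ?thesis by (simp add: J_deriv_def[abs_def])
qed

lemma abs_J_deriv_le:
  assumes "r \<ge> 0"
  shows "\<bar>J_deriv k n r\<bar> \<le> pi * cosh pi ^ k"
proof -
  have "norm (J_deriv k n r) \<le> integral {0..pi} (\<lambda>u. cosh pi ^ k)"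
    unfolding J_deriv_def
  proof (rule integral_norm_bound_integral)
    fix u :: real assume u: "u \<in> {0..pi}"
    have "cosh u \<le> cosh pi" using u by (simp add: cosh_real_nonneg_le_iff)
    then have "cosh u ^ k \<le> cosh pi ^ k" by (intro power_mono) auto
    moreover have "exp (- r * cosh u) \<le> 1" using assms by simp
    ultimately have "cosh u ^ k * exp (- r * cosh u) * \<bar>cos (real n * u)\<bar> \<le> cosh pi ^ k * 1 * 1"
      by (intro mult_mono) auto
    then show "norm ((- cosh u) ^ k * exp (- r * cosh u) * cos (real n * u)) \<le> cosh pi ^ k"
      by (simp add: abs_mult power_abs)
  qed (intro integrable_continuous_real continuous_intros)+
  then show ?thesis by (simp add: mult.commute)
qed

text \<open>
  The inhomogeneous modified Bessel equation with index \<open>i n\<close>. The left-hand side is the integral of an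
  exact derivative, and only the boundary term at \<open>u = pi\<close> survives. This term is the source of
  the Helmholtz equation.
\<close>

lemma J_bessel_equation:
  "r\<^sup>2 * J_deriv 2 n r + r * J_deriv 1 n r - r\<^sup>2 * J_deriv 0 n r + (real n)\<^sup>2 * J_deriv 0 n r =
     (- 1) ^ (n + 1) * r * sinh pi * exp (- cosh pi * r)"
proof -
  define F where "F = (\<lambda>u. real n * exp (- r * cosh u) * sin (real n * u)
      - r * sinh u * exp (- r * cosh u) * cos (real n * u))"
  define h where "h = (\<lambda>k u. (- cosh u) ^ k * exp (- r * cosh u) * cos (real n * u))"
  have h: "(h k has_integral J_deriv k n r) {0..pi}" for k
    unfolding h_def by (rule J_deriv_has_integral)
  have "((\<lambda>u. r\<^sup>2 * h 2 u + r * h 1 u - r\<^sup>2 * h 0 u + (real n)\<^sup>2 * h 0 u) has_integral (F pi - F 0)) {0..pi}"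
  proof (rule fundamental_theorem_of_calculus)
    fix u :: real
    have "(F has_field_derivative
        (real n * (exp (- r * cosh u) * (- r * sinh u)) * sin (real n * u)
        + real n * exp (- r * cosh u) * (cos (real n * u) * real n)
        - ((r * cosh u * exp (- r * cosh u) + r * sinh u * (exp (- r * cosh u) * (- r * sinh u))) * cos (real n * u)
        + r * sinh u * exp (- r * cosh u) * (- sin (real n * u) * real n)))) (at u)"
      unfolding F_def by (auto intro!: derivative_eq_intros simp: algebra_simps)
    moreover have "real n * (exp (- r * cosh u) * (- r * sinh u)) * sin (real n * u)
        + real n * exp (- r * cosh u) * (cos (real n * u) * real n)
        - ((r * cosh u * exp (- r * cosh u) + r * sinh u * (exp (- r * cosh u) * (- r * sinh u))) * cos (real n * u)
        + r * sinh u * exp (- r * cosh u) * (- sin (real n * u) * real n))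
        = (r\<^sup>2 * (sinh u)\<^sup>2 - r * cosh u + (real n)\<^sup>2) * exp (- r * cosh u) * cos (real n * u)"
      by (simp add: algebra_simps power2_eq_square)
    moreover have "\<dots> = r\<^sup>2 * h 2 u + r * h 1 u - r\<^sup>2 * h 0 u + (real n)\<^sup>2 * h 0 u"
      by (simp add: h_def sinh_square_eq algebra_simps)
    ultimately have "(F has_field_derivative r\<^sup>2 * h 2 u + r * h 1 u - r\<^sup>2 * h 0 u + (real n)\<^sup>2 * h 0 u) (at u)"
      by simp
    then show "(F has_vector_derivative r\<^sup>2 * h 2 u + r * h 1 u - r\<^sup>2 * h 0 u + (real n)\<^sup>2 * h 0 u) (at u within {0..pi})"
      unfolding has_real_derivative_iff_has_vector_derivative by (rule has_vector_derivative_at_within)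
  qed simp
  moreover have "((\<lambda>u. r\<^sup>2 * h 2 u + r * h 1 u - r\<^sup>2 * h 0 u + (real n)\<^sup>2 * h 0 u) has_integral
      (r\<^sup>2 * J_deriv 2 n r + r * J_deriv 1 n r - r\<^sup>2 * J_deriv 0 n r + (real n)\<^sup>2 * J_deriv 0 n r)) {0..pi}"
    by (intro has_integral_add has_integral_diff has_integral_mult_right h)
  ultimately have "r\<^sup>2 * J_deriv 2 n r + r * J_deriv 1 n r - r\<^sup>2 * J_deriv 0 n r + (real n)\<^sup>2 * J_deriv 0 n r = F pi - F 0"
    using has_integral_unique by blast
  also have "\<dots> = (- 1) ^ (n + 1) * r * sinh pi * exp (- cosh pi * r)"
    by (simp add: F_def mult_ac)
  finally show ?thesis .
qed

text \<open>
  The weight in the Laplace-type representation of the boundary function.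
\<close>

definition sinh_kernel :: "real \<Rightarrow> real \<Rightarrow> real" where
  "sinh_kernel r u = sinh u * exp (- r * cosh u)"

lemma continuous_on_sinh_kernel [continuous_intros]: "continuous_on A (sinh_kernel r)"
  unfolding sinh_kernel_def by (intro continuous_intros)

text \<open>
  One integration by parts turns \<open>n J(r, i n, pi)\<close> into a sine coefficient.
\<close>

lemma times_J_eq_sine_coeff: "real n * J_deriv 0 n r = r * sine_coeff (sinh_kernel r) n"
proof -
  define F where "F = (\<lambda>u. exp (- r * cosh u) * sin (real n * u))"
  have "((\<lambda>u. real n * ((- cosh u) ^ 0 * exp (- r * cosh u) * cos (real n * u))
      - r * (sinh_kernel r u * sin (real n * u))) has_integral (F pi - F 0)) {0..pi}"
    unfolding F_def sinh_kernel_def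
    by (rule fundamental_theorem_of_calculus)
       (auto intro!: derivative_eq_intros simp: algebra_simps simp flip: has_real_derivative_iff_has_vector_derivative)
  moreover have "((\<lambda>u. real n * ((- cosh u) ^ 0 * exp (- r * cosh u) * cos (real n * u))
      - r * (sinh_kernel r u * sin (real n * u))) has_integral
      (real n * J_deriv 0 n r - r * sine_coeff (sinh_kernel r) n)) {0..pi}"
    unfolding sine_coeff_def
    by (intro has_integral_diff has_integral_mult_right J_deriv_has_integral integrable_integral
        integrable_continuous_real continuous_intros)
  ultimately have "real n * J_deriv 0 n r - r * sine_coeff (sinh_kernel r) n = F pi - F 0"
    using has_integral_unique by blast
  then show ?thesis by (simp add: F_def)
qed

text \<open>
  A bound for \<open>\<bar>n\<^sup>2 J(r, i n, pi)\<bar>\<close> that is uniform in \<open>n\<close>, for \<open>r \<ge> 0\<close>; it tends to 0 at infinity.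
\<close>

definition J_decay :: "real \<Rightarrow> real" where
  "J_decay r = r * exp (- r) * (sinh pi + pi * (cosh pi + r * (sinh pi)\<^sup>2))"

text \<open>
  A second integration by parts gains another factor \<open>n\<close>. The boundary term at \<open>pi\<close> does not vanish,
  so the quadratic rate is the best that this argument yields.
\<close>

lemma sq_times_J_le:
  assumes "r \<ge> 0"
  shows "(real n)\<^sup>2 * \<bar>J_deriv 0 n r\<bar> \<le> J_decay r"
proof -
  define d where "d = (\<lambda>u. (cosh u - r * (sinh u)\<^sup>2) * exp (- r * cosh u))"
  define F where "F = (\<lambda>u. - sinh_kernel r u * cos (real n * u))"
  have e: "exp (- r * cosh u) \<le> exp (- r)" for u
    using assms mult_left_mono[OF cosh_real_ge_1[of u]] by simp
  have "((\<lambda>u. real n * (sinh_kernel r u * sin (real n * u)) - d u * cos (real n * u)) has_integral (F pi - F 0)) {0..pi}"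
    unfolding F_def sinh_kernel_def d_def
    by (rule fundamental_theorem_of_calculus)
       (auto intro!: derivative_eq_intros simp: algebra_simps power2_eq_square simp flip: has_real_derivative_iff_has_vector_derivative)
  moreover have "((\<lambda>u. real n * (sinh_kernel r u * sin (real n * u)) - d u * cos (real n * u)) has_integral
      (real n * sine_coeff (sinh_kernel r) n - integral {0..pi} (\<lambda>u. d u * cos (real n * u)))) {0..pi}"
    unfolding sine_coeff_def
    by (intro has_integral_diff has_integral_mult_right integrable_integral
        integrable_continuous_real continuous_intros) (auto simp: d_def intro!: continuous_intros)
  ultimately have "F pi - F 0 = real n * sine_coeff (sinh_kernel r) n - integral {0..pi} (\<lambda>u. d u * cos (real n * u))"
    by (rule has_integral_unique)
  then have "real n * sine_coeff (sinh_kernel r) n = F pi - F 0 + integral {0..pi} (\<lambda>u. d u * cos (real n * u))"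
    by simp
  moreover have "\<bar>F pi - F 0\<bar> \<le> sinh pi * exp (- r)"
    using e[of pi] by (simp add: F_def sinh_kernel_def abs_mult)
  moreover have "norm (integral {0..pi} (\<lambda>u. d u * cos (real n * u))) \<le> 
      integral {0..pi} (\<lambda>u. (cosh pi + r * (sinh pi)\<^sup>2) * exp (- r))"
  proof (rule integral_norm_bound_integral)
    fix u :: real assume u: "u \<in> {0..pi}"
    have "cosh u \<le> cosh pi" "sinh u \<le> sinh pi" using u by (auto simp: cosh_real_nonneg_le_iff)
    moreover from this have "r * (sinh u)\<^sup>2 \<le> r * (sinh pi)\<^sup>2"
      using u assms by (intro mult_left_mono power_mono) auto
    moreover have "0 \<le> r * (sinh u)\<^sup>2" using assms by simp
    ultimately have "\<bar>cosh u - r * (sinh u)\<^sup>2\<bar> \<le> cosh pi + r * (sinh pi)\<^sup>2"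
      using cosh_real_pos[of u] by linarith
    then have "\<bar>cosh u - r * (sinh u)\<^sup>2\<bar> * exp (- r * cosh u) * \<bar>cos (real n * u)\<bar>
        \<le> (cosh pi + r * (sinh pi)\<^sup>2) * exp (- r) * 1"
      using e[of u] assms by (intro mult_mono) (auto intro!: add_nonneg_nonneg)
    then show "norm (d u * cos (real n * u)) \<le> (cosh pi + r * (sinh pi)\<^sup>2) * exp (- r)"
      by (simp add: d_def abs_mult)
  qed (auto simp: d_def intro!: integrable_continuous_real continuous_intros)
  moreover have "integral {0..pi} (\<lambda>u. (cosh pi + r * (sinh pi)\<^sup>2) * exp (- r)) = (cosh pi + r * (sinh pi)\<^sup>2) * exp (- r) * pi"
    by simp
  ultimately have "\<bar>real n * sine_coeff (sinh_kernel r) n\<bar> \<le> sinh pi * exp (- r) + (cosh pi + r * (sinh pi)\<^sup>2) * exp (- r) * pi"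
    unfolding real_norm_def by linarith
  then have "r * \<bar>real n * sine_coeff (sinh_kernel r) n\<bar> \<le> r * (sinh pi * exp (- r) + (cosh pi + r * (sinh pi)\<^sup>2) * exp (- r) * pi)"
    using assms by (rule mult_left_mono)
  also have "\<dots> = J_decay r" by (simp add: J_decay_def algebra_simps)
  also have "r * \<bar>real n * sine_coeff (sinh_kernel r) n\<bar> = real n * \<bar>r * sine_coeff (sinh_kernel r) n\<bar>"
    using assms by (simp add: abs_mult)
  also have "\<dots> = (real n)\<^sup>2 * \<bar>J_deriv 0 n r\<bar>"
    by (simp add: abs_mult power2_eq_square flip: times_J_eq_sine_coeff)
  finally show ?thesis .
qed

lemma J_decay_tendsto_0: "(J_decay \<longlongrightarrow> 0) at_top"
proof -
  have p: "((\<lambda>r::real. r ^ k / exp r) \<longlongrightarrow> 0) at_top" for k :: nat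
    by (rule tendsto_power_div_exp_0)
  have "((\<lambda>r::real. (sinh pi + pi * cosh pi) * (r ^ 1 / exp r) + pi * (sinh pi)\<^sup>2 * (r ^ 2 / exp r)) \<longlongrightarrow>
      (sinh pi + pi * cosh pi) * 0 + pi * (sinh pi)\<^sup>2 * 0) at_top"
    by (intro tendsto_intros p)
  moreover have "(sinh pi + pi * cosh pi) * (r ^ 1 / exp r) + pi * (sinh pi)\<^sup>2 * (r ^ 2 / exp r) = J_decay r" for r
    by (simp add: J_decay_def exp_minus field_simps power2_eq_square)
  ultimately show ?thesis by simp
qed

section \<open>Kontorovich-Lebedev coefficients as sine coefficients\<close>

lemma borel_measurable_cosh_real [measurable]: "(cosh :: real \<Rightarrow> real) \<in> borel_measurable borel"
  by (intro borel_measurable_continuous_onI continuous_intros)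

text \<open>
  The Macdonald function \<open>K\<close> with the imaginary index \<open>i \<nu>\<close>, which is real-valued.
\<close>

definition K_imag :: "real \<Rightarrow> real \<Rightarrow> real" where
  "K_imag \<nu> x = (LBINT u:{0<..}. exp (- x * cosh u) * cos (\<nu> * u))"

lemma macdonald_K_imaginary:
  "macdonald_K (\<i> * of_nat n) x = complex_of_real (K_imag (real n) x)"
proof -
  have "cosh (\<i> * of_nat n * complex_of_real u) = complex_of_real (cos (real n * u))" for u
  proof -
    have "cosh (\<i> * complex_of_real (real n * u)) = complex_of_real (cos (real n * u))"
      by (simp only: cos_conv_cosh[symmetric] cos_of_real)
    then show ?thesis by (simp add: mult.assoc)
  qed
  then show ?thesis
    by (simp add: macdonald_K_def K_imag_def flip: set_integral_complex_of_real of_real_mult)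
qed

text \<open>
  The integrand, in \<open>v\<close> and \<open>x\<close>, of the double integral for the Laplace transform of \<open>K_imag \<nu>\<close> at
  \<open>cosh u\<close>, extended by 0 to the whole plane.
\<close>

definition K_double :: "real \<Rightarrow> real \<Rightarrow> real \<Rightarrow> real \<Rightarrow> real" where
  "K_double \<nu> u v x = indicator {0<..} v * indicator {0<..} x * (exp (- x * (cosh u + cosh v)) * cos (\<nu> * v))"

lemma K_double_measurable [measurable]:
  "(\<lambda>(v, x). K_double \<nu> u v x) \<in> borel_measurable (lborel \<Otimes>\<^sub>M lborel)"
  unfolding K_double_def case_prod_beta by measurable

lemma K_double_inner:
  "integrable lborel (K_double \<nu> u v)"
  "(LBINT x. K_double \<nu> u v x) = indicator {0<..} v * (cos (\<nu> * v) / (cosh u + cosh v))"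
  "(LBINT x. norm (K_double \<nu> u v x)) = indicator {0<..} v * (\<bar>cos (\<nu> * v)\<bar> / (cosh u + cosh v))"
proof -
  have pos: "cosh u + cosh v > 0" using add_pos_pos[OF cosh_real_pos[of u] cosh_real_pos[of v]] .
  note e = set_integral_exp_neg[OF pos, unfolded set_integrable_def set_lebesgue_integral_def real_scaleR_def]
  have K: "K_double \<nu> u v x = (indicator {0<..} v * cos (\<nu> * v)) * (indicator {0<..} x * exp (- x * (cosh u + cosh v)))" for x
    by (simp add: K_double_def mult_ac)
  have N: "norm (K_double \<nu> u v x) = (indicator {0<..} v * \<bar>cos (\<nu> * v)\<bar>) * (indicator {0<..} x * exp (- x * (cosh u + cosh v)))" for x
    by (simp add: K_double_def abs_mult mult_ac)
  show "integrable lborel (K_double \<nu> u v)" unfolding K by (intro integrable_mult_right e(1))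
  show "(LBINT x. K_double \<nu> u v x) = indicator {0<..} v * (cos (\<nu> * v) / (cosh u + cosh v))"
    unfolding K by (simp only: integral_mult_right_zero e(2)) simp
  show "(LBINT x. norm (K_double \<nu> u v x)) = indicator {0<..} v * (\<bar>cos (\<nu> * v)\<bar> / (cosh u + cosh v))"
    unfolding N by (simp only: integral_mult_right_zero e(2)) simp
qed

lemma integrable_K_double:
  "integrable (lborel \<Otimes>\<^sub>M lborel) (\<lambda>(v, x). K_double \<nu> u v x)"
proof (rule lborel_pair.Fubini_integrable)
  have "integrable lborel (\<lambda>v. norm (indicator {0<..} v *\<^sub>R (cos (\<nu> * v) / (cosh u + cosh v))))"
    using set_integrable_cos_over_cosh_sum[of \<nu> u] unfolding set_integrable_def by (rule integrable_norm)
  moreover have "norm (indicator {0<..} v *\<^sub>R (cos (\<nu> * v) / (cosh u + cosh v))) =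
      (LBINT x. norm (K_double \<nu> u v x))" for v
    using add_pos_pos[OF cosh_real_pos[of u] cosh_real_pos[of v]]
    by (simp add: K_double_inner(3)[unfolded real_norm_def] abs_mult abs_divide)
  ultimately show "integrable lborel (\<lambda>v. LBINT x. norm (case (v, x) of (v, x) \<Rightarrow> K_double \<nu> u v x))"
    by simp
qed (auto simp: K_double_inner(1))

lemma K_double_outer:
  "(LBINT v. K_double \<nu> u v x) = indicator {0<..} x * (exp (- x * cosh u) * K_imag \<nu> x)"
proof -
  have "K_double \<nu> u v x = indicator {0<..} x * exp (- x * cosh u) * (indicator {0<..} v *\<^sub>R (exp (- x * cosh v) * cos (\<nu> * v)))" for v
    by (simp add: K_double_def distrib_left exp_add exp_diff exp_minus divide_inverse)
  then show ?thesis
    by (simp add: K_imag_def set_lebesgue_integral_def mult.assoc)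
qed

text \<open>
  The Laplace transform of \<open>K_imag \<nu>\<close> at \<open>cosh u\<close>, with the order of integration exchanged.
\<close>

lemma K_imag_laplace:
  shows "set_integrable lborel {0<..} (\<lambda>x. exp (- x * cosh u) * K_imag \<nu> x)"
    and "(LBINT x:{0<..}. exp (- x * cosh u) * K_imag \<nu> x) = (LBINT v:{0<..}. cos (\<nu> * v) / (cosh u + cosh v))"
proof -
  have "integrable lborel (\<lambda>x. LBINT v. K_double \<nu> u v x)"
    by (rule lborel_pair.integrable_snd[OF integrable_K_double])
  then show "set_integrable lborel {0<..} (\<lambda>x. exp (- x * cosh u) * K_imag \<nu> x)"
    by (simp add: K_double_outer set_integrable_def)
  have "(LBINT x. LBINT v. K_double \<nu> u v x) = (LBINT v. LBINT x. K_double \<nu> u v x)"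
    by (rule lborel_pair.Fubini_integral[OF integrable_K_double])
  then show "(LBINT x:{0<..}. exp (- x * cosh u) * K_imag \<nu> x) = (LBINT v:{0<..}. cos (\<nu> * v) / (cosh u + cosh v))"
    by (simp add: K_double_outer K_double_inner set_lebesgue_integral_def)
qed

text \<open>
  The factor \<open>sinh u\<close> makes the formula valid for all real \<open>u\<close>, including \<open>u = 0\<close>.
\<close>

lemma sinh_times_K_imag_laplace:
  assumes "\<nu> > 0"
  shows "sinh u * (LBINT x:{0<..}. exp (- x * cosh u) * K_imag \<nu> x) = pi / sinh (\<nu> * pi) * sin (\<nu> * u)"
proof (cases u "0::real" rule: linorder_cases)
  case less
  then show ?thesis
    unfolding K_imag_laplace(2) using integral_cos_over_cosh_sum[of "- u" \<nu>] assms by simp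
next
  case greater
  then show ?thesis
    unfolding K_imag_laplace(2) using integral_cos_over_cosh_sum[of u \<nu>] assms by simp
qed simp

lemma borel_measurable_K_imag [measurable]: "K_imag \<nu> \<in> borel_measurable borel"
proof -
  have "(\<lambda>x. LINT u|lborel. indicator {0<..} u *\<^sub>R (exp (- x * cosh u) * cos (\<nu> * u))) \<in> borel_measurable borel"
    by (rule lborel.borel_measurable_lebesgue_integral) measurable
  then show ?thesis by (simp add: K_imag_def[abs_def] set_lebesgue_integral_def)
qed

theorem kontorovich_lebedev_of_laplace_representation:
  fixes f \<psi> :: "real \<Rightarrow> complex"
  assumes f_repr: "\<And>x. x > 0 \<Longrightarrow> f x / complex_of_real x =
      (LBINT u=-pi..pi. complex_of_real (exp (- x * cosh u)) * \<psi> u * complex_of_real (sinh u))"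
    and \<psi>: "continuous_on {-pi..pi} \<psi>" and n: "n \<ge> 1"
  shows "kontorovich_lebedev f n = complex_of_real (pi / sinh (real n * pi)) *
      (LBINT u:{-pi..pi}. \<psi> u * complex_of_real (sin (real n * u)))"
proof -
  define q where "q = (\<lambda>u. indicator {-pi..pi} u *\<^sub>R (\<psi> u * complex_of_real (sinh u)))"
  define E where "E = (\<lambda>u x. indicator {0<..} x * (exp (- x * cosh u) * K_imag (real n) x))"
  define H where "H = (\<lambda>u x. complex_of_real (E u x) * q u)"
  have cq: "continuous_on {-pi..pi} (\<lambda>u. \<psi> u * complex_of_real (sinh u))"
    by (intro continuous_intros \<psi>)
  have q [measurable]: "q \<in> borel_measurable borel"
    unfolding q_def by (rule borel_measurable_continuous_on_indicator[OF _ cq]) simp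
  have qi: "integrable lborel q"
    using borel_integrable_atLeastAtMost'[OF cq] by (simp add: q_def set_integrable_def)
  have E_meas [measurable]: "(\<lambda>(u, x). E u x) \<in> borel_measurable (lborel \<Otimes>\<^sub>M lborel)"
    unfolding E_def case_prod_beta by measurable
  have H_meas [measurable]: "(\<lambda>(u, x). H u x) \<in> borel_measurable (lborel \<Otimes>\<^sub>M lborel)"
    unfolding H_def E_def case_prod_beta by measurable
  have Ei: "integrable lborel (E u)" for u
    using K_imag_laplace(1)[of u "real n"] by (simp add: E_def[abs_def] set_integrable_def)
  have H_int: "integrable (lborel \<Otimes>\<^sub>M lborel) (\<lambda>(u, x). H u x)"
  proof (rule lborel_pair.Fubini_integrable)
    have "integrable lborel (\<lambda>u. LBINT x. norm (H u x))"
    proof (rule Bochner_Integration.integrable_bound)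
      show "integrable lborel (\<lambda>u. norm (q u) * (LBINT x. norm (E 0 x)))"
        using qi by (intro integrable_mult_left integrable_norm)
      show "(\<lambda>u. LBINT x. norm (H u x)) \<in> borel_measurable lborel"
        by (rule lborel.borel_measurable_lebesgue_integral) measurable
      \<comment> \<open>since \<open>cosh u \<ge> 1\<close>, the value at \<open>u = 0\<close> dominates the integral over x for every u\<close>
      have "norm (LBINT x. norm (H u x)) \<le> norm (norm (q u) * (LBINT x. norm (E 0 x)))" for u
      proof -
        have "(LBINT x. norm (E u x)) \<le> (LBINT x. norm (E 0 x))"
        proof (rule integral_mono)
          fix x :: real
          show "norm (E u x) \<le> norm (E 0 x)"
            using mult_left_mono[OF cosh_real_ge_1[of u], of x]
            by (auto simp: E_def abs_mult indicator_def intro!: mult_right_mono)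
        qed (intro integrable_norm Ei)+
        moreover have "(LBINT x. norm (H u x)) = norm (q u) * (LBINT x. norm (E u x))"
          by (simp add: H_def norm_mult mult.commute)
        moreover have "0 \<le> (LBINT x. norm (E u x))" by simp
        ultimately show ?thesis by (simp add: abs_mult mult_left_mono)
      qed
      then show "AE u in lborel. norm (LBINT x. norm (H u x)) \<le> norm (norm (q u) * (LBINT x. norm (E 0 x)))"
        by simp
    qed
    then show "integrable lborel (\<lambda>u. LBINT x. norm (case (u, x) of (u, x) \<Rightarrow> H u x))" by simp
    show "AE u in lborel. integrable lborel (\<lambda>x. case (u, x) of (u, x) \<Rightarrow> H u x)"
      using Ei by (simp add: H_def integrable_of_real)
  qed measurable
  have "kontorovich_lebedev f n = (LBINT x. LBINT u. H u x)"
    unfolding kontorovich_lebedev_def set_lebesgue_integral_def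
  proof (rule Bochner_Integration.integral_cong[OF refl])
    fix x :: real
    show "indicator {0<..} x *\<^sub>R (macdonald_K (\<i> * of_nat n) x * f x / complex_of_real x) = (LBINT u. H u x)"
    proof (cases "x > 0")
      case True
      have "f x / complex_of_real x = (LBINT u:{-pi..pi}. complex_of_real (exp (- x * cosh u)) * \<psi> u * complex_of_real (sinh u))"
        unfolding f_repr[OF True] by (rule interval_integral_Icc) simp
      also have "\<dots> = (LBINT u. complex_of_real (exp (- x * cosh u)) * q u)"
        by (simp add: q_def set_lebesgue_integral_def mult.assoc)
      finally have "complex_of_real (K_imag (real n) x) * (f x / complex_of_real x) =
          (LBINT u. complex_of_real (K_imag (real n) x) * (complex_of_real (exp (- x * cosh u)) * q u))"
        by (simp only: integral_mult_right_zero)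
      then show ?thesis using True
        by (simp add: macdonald_K_imaginary H_def E_def mult_ac)
    qed (simp add: H_def E_def)
  qed
  also have "\<dots> = (LBINT u. LBINT x. H u x)"
    by (rule lborel_pair.Fubini_integral[OF H_int])
  also have "\<dots> = (LBINT u. complex_of_real (pi / sinh (real n * pi)) *
      (indicator {-pi..pi} u *\<^sub>R (\<psi> u * complex_of_real (sin (real n * u)))))"
  proof (rule Bochner_Integration.integral_cong[OF refl])
    fix u :: real
    have "(LBINT x. H u x) = complex_of_real (LBINT x. E u x) * q u"
      by (simp add: H_def)
    also have "\<dots> = indicator {-pi..pi} u *\<^sub>R (\<psi> u * complex_of_real (sinh u * (LBINT x. E u x)))"
      by (simp add: q_def)
    also have "sinh u * (LBINT x. E u x) = pi / sinh (real n * pi) * sin (real n * u)"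
      using sinh_times_K_imag_laplace[of "real n" u] n by (simp add: E_def set_lebesgue_integral_def)
    finally show "(LBINT x. H u x) = complex_of_real (pi / sinh (real n * pi)) *
      (indicator {-pi..pi} u *\<^sub>R (\<psi> u * complex_of_real (sin (real n * u))))"
      by simp
  qed
  also have "\<dots> = complex_of_real (pi / sinh (real n * pi)) *
      (LBINT u:{-pi..pi}. \<psi> u * complex_of_real (sin (real n * u)))"
    by (simp only: integral_mult_right_zero set_lebesgue_integral_def)
  finally show ?thesis .
qed

section \<open>The Helmholtz equation for exponentially decaying coefficients\<close>

text \<open>
  Termwise differentiation of a pointwise convergent series on an open interval, under a Weierstrass
  majorant for the derivatives.
\<close>

lemma has_vector_derivative_suminf:
  fixes f :: "nat \<Rightarrow> real \<Rightarrow> 'b::banach"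
  assumes S: "open S" "convex S" "x \<in> S"
    and f: "\<And>n x. x \<in> S \<Longrightarrow> (f n has_vector_derivative f' n x) (at x)"
    and M: "\<And>n x. x \<in> S \<Longrightarrow> norm (f' n x) \<le> M n" "summable M"
    and conv: "\<And>x. x \<in> S \<Longrightarrow> summable (\<lambda>n. f n x)"
  shows "((\<lambda>x. \<Sum>n. f n x) has_vector_derivative (\<Sum>n. f' n x)) (at x)"
proof -
  have u: "uniform_limit S (\<lambda>n x. \<Sum>i<n. f' i x) (\<lambda>x. \<Sum>i. f' i x) sequentially"
    by (rule Weierstrass_m_test[OF M])
  have "\<exists>g. \<forall>x\<in>S. (\<lambda>n. f n x) sums (g x) \<and> (g has_derivative (\<lambda>h. h *\<^sub>R (\<Sum>i. f' i x))) (at x within S)"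
  proof (rule has_derivative_series[OF S(2)])
    show "(f n has_derivative (\<lambda>h. h *\<^sub>R f' n x)) (at x within S)" if "x \<in> S" for n x
      using f[OF that] has_derivative_at_withinI unfolding has_vector_derivative_def by blast
    show "\<forall>\<^sub>F n in sequentially. \<forall>x\<in>S. \<forall>h. norm ((\<Sum>i<n. h *\<^sub>R f' i x) - h *\<^sub>R (\<Sum>i. f' i x)) \<le> e * norm h"
      if "e > 0" for e
      using uniform_limitD[OF u that]
    proof eventually_elim
      case (elim n)
      show ?case
      proof (intro ballI allI)
        fix x h assume "x \<in> S"
        then have "norm ((\<Sum>i<n. f' i x) - (\<Sum>i. f' i x)) \<le> e" using elim by (simp add: dist_norm less_imp_le)
        then have "\<bar>h\<bar> * norm ((\<Sum>i<n. f' i x) - (\<Sum>i. f' i x)) \<le> \<bar>h\<bar> * e" by (rule mult_left_mono) simp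
        then show "norm ((\<Sum>i<n. h *\<^sub>R f' i x) - h *\<^sub>R (\<Sum>i. f' i x)) \<le> e * norm h"
          by (simp add: mult.commute flip: scaleR_sum_right scaleR_diff_right)
      qed
    qed
    show "x \<in> S" by fact
    show "(\<lambda>n. f n x) sums (\<Sum>n. f n x)" using conv[OF S(3)] by (rule summable_sums)
  qed
  then obtain g where g: "\<And>x. x \<in> S \<Longrightarrow> (\<lambda>n. f n x) sums (g x)"
    "\<And>x. x \<in> S \<Longrightarrow> (g has_derivative (\<lambda>h. h *\<^sub>R (\<Sum>i. f' i x))) (at x within S)" by blast
  have "(g has_derivative (\<lambda>h. h *\<^sub>R (\<Sum>i. f' i x))) (at x)"
    using g(2)[OF S(3)] at_within_open[OF S(3,1)] by simp
  then show ?thesis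
    unfolding has_vector_derivative_def
    by (rule has_derivative_transform_within_open[OF _ S(1,3)]) (use g(1) sums_unique in blast)
qed

lemma sinh_le_exp: "sinh x \<le> exp x" and cosh_le_exp: "x \<ge> 0 \<Longrightarrow> cosh x \<le> exp x" for x :: real
proof -
  have "sinh x \<le> cosh x + sinh x" using cosh_real_nonneg by simp
  then show "sinh x \<le> exp x" by (simp only: cosh_plus_sinh)
  assume "x \<ge> 0"
  then have "cosh x \<le> cosh x + sinh x" by simp
  then show "cosh x \<le> exp x" by (simp only: cosh_plus_sinh)
qed

lemma norm_r_term_le:
  assumes "r \<ge> 0" "\<theta> \<ge> 0"
  shows "norm (complex_of_real (J_deriv k n r) * (complex_of_real (real n * sinh (\<theta> * real n)) * a n))
    \<le> (pi * cosh pi ^ k) * (real n ^ 1 * exp (\<theta> * real n) * cmod (a n))"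
proof -
  have "\<bar>J_deriv k n r\<bar> * (real n * sinh (\<theta> * real n) * cmod (a n)) \<le>
      (pi * cosh pi ^ k) * (real n * exp (\<theta> * real n) * cmod (a n))"
    using assms by (intro mult_mono abs_J_deriv_le mult_nonneg_nonneg sinh_le_exp) auto
  then show ?thesis using assms by (simp add: norm_mult abs_mult mult.assoc)
qed

lemma norm_t_term_le:
  assumes "r \<ge> 0" "0 \<le> \<theta>" "\<theta> \<le> \<theta>'" "h = sinh \<or> h = cosh"
  shows "norm (complex_of_real (real n ^ k * h (\<theta> * real n)) * (complex_of_real (J_deriv 0 n r) * a n))
    \<le> pi * (real n ^ k * exp (\<theta>' * real n) * cmod (a n))"
proof -
  have "\<bar>h (\<theta> * real n)\<bar> \<le> exp (\<theta> * real n)"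
    using assms sinh_le_exp cosh_le_exp[of "\<theta> * real n"] by auto
  also have "\<dots> \<le> exp (\<theta>' * real n)" using assms by (simp add: mult_right_mono)
  finally have "(real n ^ k * \<bar>h (\<theta> * real n)\<bar>) * (\<bar>J_deriv 0 n r\<bar> * cmod (a n)) \<le>
      (real n ^ k * exp (\<theta>' * real n)) * (pi * cmod (a n))"
    using assms abs_J_deriv_le[of r 0 n] by (intro mult_mono) auto
  then show ?thesis by (simp add: norm_mult norm_power abs_mult mult_ac)
qed

text \<open>
  Coefficients \<open>a\<^sub>1, a\<^sub>2, \<dots>\<close> with the decay that makes the series for \<open>u\<close> and its derivatives converge
  locally uniformly for \<open>0 < \<theta> < pi\<close>; the value \<open>a 0\<close> plays no role.
\<close>

locale exponentially_decaying =
  fixes a :: "nat \<Rightarrow> complex"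
  assumes a_summable: "\<And>\<theta>. 0 \<le> \<theta> \<Longrightarrow> \<theta> < pi \<Longrightarrow>
      summable (\<lambda>n. cmod (a (Suc n)) * (real (Suc n))\<^sup>2 * exp (\<theta> * real (Suc n)))"
begin

text \<open>
  The square in the decay condition may be raised to a cube, because a factor \<open>n\<close> is absorbed by an
  exponential with a slightly larger rate, still below \<open>pi\<close>.
\<close>

lemma summable_power_exp:
  assumes "k \<le> 3" "0 \<le> \<theta>" "\<theta> < pi"
  shows "summable (\<lambda>n. real (Suc n) ^ k * exp (\<theta> * real (Suc n)) * cmod (a (Suc n)))"
proof -
  define e where "e = (pi - \<theta>) / 2"
  have e: "e > 0" "0 \<le> \<theta> + e" "\<theta> + e < pi" using assms by (auto simp: e_def field_simps)
  have "norm (real (Suc n) ^ k * exp (\<theta> * real (Suc n)) * cmod (a (Suc n))) \<le>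
      1 / e * (cmod (a (Suc n)) * (real (Suc n))\<^sup>2 * exp ((\<theta> + e) * real (Suc n)))" for n
  proof -
    have "real (Suc n) * e \<le> exp (e * real (Suc n))"
      unfolding mult.commute[of "real (Suc n)" e]
      using exp_ge_add_one_self[of "e * real (Suc n)"] by linarith
    then have "real (Suc n) \<le> 1 / e * exp (e * real (Suc n))" using e by (simp add: field_simps)
    moreover have "real (Suc n) ^ k \<le> real (Suc n) ^ 3" using assms(1) by (intro power_increasing) auto
    ultimately have "real (Suc n) ^ k \<le> (1 / e * exp (e * real (Suc n))) * (real (Suc n))\<^sup>2"
      using mult_right_mono[of "real (Suc n)" "1 / e * exp (e * real (Suc n))" "(real (Suc n))\<^sup>2"]
      by (simp add: power3_eq_cube power2_eq_square mult.assoc del: of_nat_Suc)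
    then have "real (Suc n) ^ k * (exp (\<theta> * real (Suc n)) * cmod (a (Suc n))) \<le>
        ((1 / e * exp (e * real (Suc n))) * (real (Suc n))\<^sup>2) * (exp (\<theta> * real (Suc n)) * cmod (a (Suc n)))"
      by (rule mult_right_mono) simp
    moreover have "exp ((\<theta> + e) * real (Suc n)) = exp (\<theta> * real (Suc n)) * exp (e * real (Suc n))"
      by (simp only: distrib_right exp_add)
    ultimately show ?thesis by (simp add: mult_ac del: of_nat_Suc)
  qed
  then show ?thesis
    by (intro summable_comparison_test'[OF summable_mult[OF a_summable[OF e(2,3)]]])
qed

lemma summable_bounded_times:
  fixes c :: "nat \<Rightarrow> complex"
  assumes "k \<le> 3" "0 \<le> \<theta>" "\<theta> < pi"
    and "\<And>n. norm (c n) \<le> D * (real (Suc n) ^ k * exp (\<theta> * real (Suc n)) * cmod (a (Suc n)))"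
  shows "summable c"
  by (rule summable_comparison_test'[OF summable_mult[OF summable_power_exp[OF assms(1-3)]] assms(4)])

lemma r_series_summable:
  assumes "r \<ge> 0" "0 \<le> \<theta>" "\<theta> < pi"
  shows "summable (\<lambda>n. complex_of_real (J_deriv k (Suc n) r) * (complex_of_real (real (Suc n) * sinh (\<theta> * real (Suc n))) * a (Suc n)))"
  by (rule summable_bounded_times[OF _ assms(2,3) norm_r_term_le[where a = a]]) (use assms in auto)

lemma r_series_derivative:
  assumes "r > 0" "0 \<le> \<theta>" "\<theta> < pi"
  shows "((\<lambda>r. \<Sum>n. complex_of_real (J_deriv k (Suc n) r) * (complex_of_real (real (Suc n) * sinh (\<theta> * real (Suc n))) * a (Suc n)))
    has_vector_derivative
    (\<Sum>n. complex_of_real (J_deriv (Suc k) (Suc n) r) * (complex_of_real (real (Suc n) * sinh (\<theta> * real (Suc n))) * a (Suc n)))) (at r)"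
proof (rule has_vector_derivative_suminf[where S = "{0<..}"])
  show "((\<lambda>r. complex_of_real (J_deriv k (Suc n) r) * (complex_of_real (real (Suc n) * sinh (\<theta> * real (Suc n))) * a (Suc n)))
    has_vector_derivative complex_of_real (J_deriv (Suc k) (Suc n) r) * (complex_of_real (real (Suc n) * sinh (\<theta> * real (Suc n))) * a (Suc n))) (at r)" for n r
    using has_field_derivative_J_deriv[of k "Suc n" r]
    by (intro has_vector_derivative_mult_left has_vector_derivative_of_real)
       (simp add: has_real_derivative_iff_has_vector_derivative)
  show "norm (complex_of_real (J_deriv (Suc k) (Suc n) r) * (complex_of_real (real (Suc n) * sinh (\<theta> * real (Suc n))) * a (Suc n)))
    \<le> (pi * cosh pi ^ Suc k) * (real (Suc n) ^ 1 * exp (\<theta> * real (Suc n)) * cmod (a (Suc n)))" if "r \<in> {0<..}" for n r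
    using that assms by (intro norm_r_term_le) auto
  show "summable (\<lambda>n. (pi * cosh pi ^ Suc k) * (real (Suc n) ^ 1 * exp (\<theta> * real (Suc n)) * cmod (a (Suc n))))"
    using assms by (intro summable_mult summable_power_exp) auto
qed (use assms r_series_summable in auto)

lemma t_series_summable:
  assumes "r \<ge> 0" "0 \<le> \<theta>" "\<theta> < pi" "h = sinh \<or> h = cosh" "k \<le> 3"
  shows "summable (\<lambda>n. complex_of_real (real (Suc n) ^ k * h (\<theta> * real (Suc n))) * (complex_of_real (J_deriv 0 (Suc n) r) * a (Suc n)))"
  by (rule summable_bounded_times[OF assms(5) _ _ norm_t_term_le[where a = a, of r \<theta> \<theta>]]) (use assms in auto)

text \<open>
  In the angular direction each derivative brings down a factor \<open>n\<close> and exchanges \<open>sinh\<close> and \<open>cosh\<close>.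
\<close>

lemma t_series_derivative:
  assumes "r \<ge> 0" "0 < \<theta>" "\<theta> < pi" "h = sinh \<and> h' = cosh \<or> h = cosh \<and> h' = sinh" "k < 3"
  shows "((\<lambda>\<theta>. \<Sum>n. complex_of_real (real (Suc n) ^ k * h (\<theta> * real (Suc n))) * (complex_of_real (J_deriv 0 (Suc n) r) * a (Suc n)))
    has_vector_derivative
    (\<Sum>n. complex_of_real (real (Suc n) ^ Suc k * h' (\<theta> * real (Suc n))) * (complex_of_real (J_deriv 0 (Suc n) r) * a (Suc n)))) (at \<theta>)"
proof -
  define \<theta>' where "\<theta>' = (\<theta> + pi) / 2"
  have \<theta>': "\<theta> < \<theta>'" "\<theta>' < pi" "0 \<le> \<theta>'" using assms by (auto simp: \<theta>'_def)
  have h: "h = sinh \<or> h = cosh" "h' = sinh \<or> h' = cosh" using assms by auto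
  show ?thesis
  proof (rule has_vector_derivative_suminf[where S = "{0<..<\<theta>'}"])
    show "((\<lambda>\<theta>. complex_of_real (real (Suc n) ^ k * h (\<theta> * real (Suc n))) * (complex_of_real (J_deriv 0 (Suc n) r) * a (Suc n)))
      has_vector_derivative complex_of_real (real (Suc n) ^ Suc k * h' (\<theta> * real (Suc n))) * (complex_of_real (J_deriv 0 (Suc n) r) * a (Suc n))) (at \<theta>)" for n \<theta>
    proof -
      have "(h has_field_derivative h' x) (at x)" for x
        using assms(4) by (auto intro!: derivative_eq_intros)
      then have "((\<lambda>\<theta>. real (Suc n) ^ k * h (\<theta> * real (Suc n))) has_field_derivative
          real (Suc n) ^ k * (h' (\<theta> * real (Suc n)) * real (Suc n))) (at \<theta>)"
        by (intro DERIV_cmult DERIV_chain2[where f = h] DERIV_cmult_Id[where 'a = real, THEN DERIV_cong] refl)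
           (auto intro!: derivative_eq_intros)
      then show ?thesis
        by (intro has_vector_derivative_mult_left has_vector_derivative_of_real)
           (simp add: mult_ac flip: has_real_derivative_iff_has_vector_derivative)
    qed
    show "norm (complex_of_real (real (Suc n) ^ Suc k * h' (t * real (Suc n))) * (complex_of_real (J_deriv 0 (Suc n) r) * a (Suc n)))
      \<le> pi * (real (Suc n) ^ Suc k * exp (\<theta>' * real (Suc n)) * cmod (a (Suc n)))" if "t \<in> {0<..<\<theta>'}" for n t
      using that assms h by (intro norm_t_term_le) auto
    show "summable (\<lambda>n. pi * (real (Suc n) ^ Suc k * exp (\<theta>' * real (Suc n)) * cmod (a (Suc n))))"
      using assms \<theta>' by (intro summable_mult summable_power_exp) auto
    show "summable (\<lambda>n. complex_of_real (real (Suc n) ^ k * h (t * real (Suc n))) * (complex_of_real (J_deriv 0 (Suc n) r) * a (Suc n)))"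
      if "t \<in> {0<..<\<theta>'}" for t
      using that assms \<theta>' h by (intro t_series_summable) auto
  qed (use assms \<theta>' in auto)
qed

lemma source_term_summable:
  assumes "0 \<le> \<theta>" "\<theta> < pi"
  shows "summable (\<lambda>n. source_term a \<theta> (Suc n))"
proof (rule summable_bounded_times[OF _ assms])
  show "norm (source_term a \<theta> (Suc n)) \<le> 1 * (real (Suc n) ^ 1 * exp (\<theta> * real (Suc n)) * cmod (a (Suc n)))" for n
  proof -
    have "(real (Suc n) * \<bar>sinh (\<theta> * real (Suc n))\<bar>) * cmod (a (Suc n)) \<le> (real (Suc n) * exp (\<theta> * real (Suc n))) * cmod (a (Suc n))"
      using assms sinh_le_exp[of "\<theta> * real (Suc n)"] by (intro mult_mono) auto
    then show ?thesis
      by (simp add: source_term_def norm_mult norm_power abs_mult mult_ac del: of_nat_Suc)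
  qed
qed simp

theorem u_series_solves_helmholtz: "solves_helmholtz_polar (u_series a) (helmholtz_source a)"
proof -
  define c where "c = complex_of_real (2 / pi\<^sup>2)"
  define A where "A = (\<lambda>\<theta> n. complex_of_real (real (Suc n) * sinh (\<theta> * real (Suc n))) * a (Suc n))"
  define R where "R = (\<lambda>k r \<theta>. \<Sum>n. complex_of_real (J_deriv k (Suc n) r) * A \<theta> n)"
  define B where "B = (\<lambda>r n. complex_of_real (J_deriv 0 (Suc n) r) * a (Suc n))"
  define T where "T = (\<lambda>(h :: real \<Rightarrow> real) k r \<theta>. \<Sum>n. complex_of_real (real (Suc n) ^ k * h (\<theta> * real (Suc n))) * B r n)"
  have uR: "u_series a r \<theta> = c * R 0 r \<theta>" for r \<theta>
    by (simp add: u_series_def u_term_def c_def R_def A_def incomplete_J_eq mult_ac del: of_nat_Suc)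
  have uT: "u_series a r \<theta> = c * T sinh 1 r \<theta>" for r \<theta>
    by (simp add: u_series_def u_term_def c_def T_def B_def incomplete_J_eq mult_ac del: of_nat_Suc)
  have dR: "((\<lambda>s. c * R k s \<theta>) has_vector_derivative c * R (Suc k) r \<theta>) (at r)"
    if "0 < r" "0 < \<theta>" "\<theta> < pi" for k r \<theta>
    using that unfolding R_def A_def by (intro has_vector_derivative_mult_right r_series_derivative) auto
  have dT: "((\<lambda>t. c * T h k r t) has_vector_derivative c * T h' (Suc k) r \<theta>) (at \<theta>)"
    if "0 < r" "0 < \<theta>" "\<theta> < pi" "k < 3" "h = sinh \<and> h' = cosh \<or> h = cosh \<and> h' = sinh" for h h' k r \<theta>
    using that unfolding T_def B_def by (intro has_vector_derivative_mult_right t_series_derivative) auto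
  have pde: "c * R 2 r \<theta> + c * R 1 r \<theta> / complex_of_real r + c * T sinh 3 r \<theta> / complex_of_real (r\<^sup>2) - c * R 0 r \<theta>
      = helmholtz_source a r \<theta>" if r: "0 < r" "0 < \<theta>" "\<theta> < pi" for r \<theta>
  proof -
    have sR: "(\<lambda>n. complex_of_real (J_deriv k (Suc n) r) * A \<theta> n) sums R k r \<theta>" for k
      unfolding R_def A_def using r by (intro summable_sums r_series_summable) auto
    have sT: "(\<lambda>n. complex_of_real (real (Suc n) ^ 3 * sinh (\<theta> * real (Suc n))) * B r n) sums T sinh 3 r \<theta>"
      unfolding T_def B_def using r by (intro summable_sums t_series_summable) auto
    define K where "K = complex_of_real (sinh pi / r * exp (- cosh pi * r))"
    \<comment> \<open>each term has its own source, which comes from the inhomogeneous Bessel equation\<close>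
    have eq: "complex_of_real (J_deriv 2 (Suc n) r) * A \<theta> n + complex_of_real (J_deriv 1 (Suc n) r) * A \<theta> n / complex_of_real r
        + complex_of_real (real (Suc n) ^ 3 * sinh (\<theta> * real (Suc n))) * B r n / complex_of_real (r\<^sup>2)
        - complex_of_real (J_deriv 0 (Suc n) r) * A \<theta> n = K * source_term a \<theta> (Suc n)" for n
    proof -
      define m where "m = Suc n"
      have "J_deriv 2 m r + J_deriv 1 m r / r + (real m)\<^sup>2 * J_deriv 0 m r / r\<^sup>2 - J_deriv 0 m r =
          (r\<^sup>2 * J_deriv 2 m r + r * J_deriv 1 m r - r\<^sup>2 * J_deriv 0 m r + (real m)\<^sup>2 * J_deriv 0 m r) / r\<^sup>2"
        using r by (simp add: field_simps power2_eq_square)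
      also have "\<dots> = (- 1) ^ (m + 1) * (sinh pi / r * exp (- cosh pi * r))"
        unfolding J_bessel_equation using r by (simp add: field_simps power2_eq_square)
      finally have "(J_deriv 2 m r + J_deriv 1 m r / r + (real m)\<^sup>2 * J_deriv 0 m r / r\<^sup>2 - J_deriv 0 m r) * (real m * sinh (\<theta> * real m)) =
          (sinh pi / r * exp (- cosh pi * r)) * ((- 1) ^ (m + 1) * real m * sinh (real m * \<theta>))"
        by (simp add: mult_ac)
      then have "complex_of_real ((J_deriv 2 m r + J_deriv 1 m r / r + (real m)\<^sup>2 * J_deriv 0 m r / r\<^sup>2 - J_deriv 0 m r) * (real m * sinh (\<theta> * real m))) * a m =
          K * source_term a \<theta> m"
        by (simp only: K_def source_term_def of_real_mult mult.assoc)
      moreover have "complex_of_real ((J_deriv 2 m r + J_deriv 1 m r / r + (real m)\<^sup>2 * J_deriv 0 m r / r\<^sup>2 - J_deriv 0 m r) * (real m * sinh (\<theta> * real m))) * a m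
        = complex_of_real (J_deriv 2 m r) * A \<theta> n + complex_of_real (J_deriv 1 m r) * A \<theta> n / complex_of_real r
        + complex_of_real (real m ^ 3 * sinh (\<theta> * real m)) * B r n / complex_of_real (r\<^sup>2)
        - complex_of_real (J_deriv 0 m r) * A \<theta> n"
        unfolding A_def B_def m_def[symmetric] using r
        by (simp add: field_simps power2_eq_square power3_eq_cube)
      ultimately show ?thesis by (simp only: m_def)
    qed
    have "(\<lambda>n. K * source_term a \<theta> (Suc n)) sums
        (R 2 r \<theta> + R 1 r \<theta> / complex_of_real r + T sinh 3 r \<theta> / complex_of_real (r\<^sup>2) - R 0 r \<theta>)"
      unfolding eq[symmetric] by (intro sums_add sums_diff sums_divide sR sT)
    moreover have "(\<lambda>n. K * source_term a \<theta> (Suc n)) sums (K * (\<Sum>n. source_term a \<theta> (Suc n)))"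
      using r by (intro sums_mult summable_sums source_term_summable) auto
    ultimately have "R 2 r \<theta> + R 1 r \<theta> / complex_of_real r + T sinh 3 r \<theta> / complex_of_real (r\<^sup>2) - R 0 r \<theta> =
        K * (\<Sum>n. source_term a \<theta> (Suc n))" by (rule sums_unique2)
    then have "c * (R 2 r \<theta> + R 1 r \<theta> / complex_of_real r + T sinh 3 r \<theta> / complex_of_real (r\<^sup>2) - R 0 r \<theta>) =
        (c * K) * (\<Sum>n. source_term a \<theta> (Suc n))" by simp
    also have "c * K = complex_of_real (2 * sinh pi / (pi\<^sup>2 * r) * exp (- cosh pi * r))"
      by (simp add: c_def K_def)
    finally show ?thesis
      by (simp only: helmholtz_source_def distrib_left right_diff_distrib times_divide_eq_right)
  qed
  show ?thesis
    unfolding solves_helmholtz_polar_def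
  proof (rule exI[of _ "\<lambda>r \<theta>. c * R 1 r \<theta>"], rule exI[of _ "\<lambda>r \<theta>. c * R 2 r \<theta>"],
      rule exI[of _ "\<lambda>r \<theta>. c * T cosh 2 r \<theta>"], rule exI[of _ "\<lambda>r \<theta>. c * T sinh 3 r \<theta>"],
      intro allI impI, elim conjE, intro conjI)
    fix r \<theta> :: real assume r: "0 < r" "0 < \<theta>" "\<theta> < pi"
    show "((\<lambda>s. u_series a s \<theta>) has_vector_derivative c * R 1 r \<theta>) (at r)"
      using dR[OF r, of 0] by (simp add: uR)
    show "((\<lambda>s. c * R 1 s \<theta>) has_vector_derivative c * R 2 r \<theta>) (at r)"
      using dR[OF r, of 1] by (simp add: numeral_2_eq_2)
    show "((\<lambda>t. u_series a r t) has_vector_derivative c * T cosh 2 r \<theta>) (at \<theta>)"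
      using dT[OF r, of 1 sinh cosh] by (simp add: uT numeral_2_eq_2)
    show "((\<lambda>t. c * T cosh 2 r t) has_vector_derivative c * T sinh 3 r \<theta>) (at \<theta>)"
      using dT[OF r, of 2 cosh sinh] by (simp add: numeral_3_eq_3 numeral_2_eq_2)
    show "c * R 2 r \<theta> + c * R 1 r \<theta> / complex_of_real r + c * T sinh 3 r \<theta> / complex_of_real (r\<^sup>2) - u_series a r \<theta>
        = helmholtz_source a r \<theta>"
      using pde[OF r] by (simp only: uR)
  qed
qed

end

section \<open>Boundary values and decay\<close>

text \<open>
  Sine coefficients of a complex-valued function, normalised like \<open>sine_coeff\<close>.
\<close>

definition complex_sine_coeff :: "(real \<Rightarrow> complex) \<Rightarrow> nat \<Rightarrow> complex" where
  "complex_sine_coeff \<phi> n = integral {0..pi} (\<lambda>u. \<phi> u * complex_of_real (sin (real n * u)))"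

lemma complex_integral_split:
  fixes \<phi> :: "real \<Rightarrow> complex"
  assumes "continuous_on {a..b} \<phi>" "continuous_on {a..b} g"
  shows "integral {a..b} (\<lambda>u. \<phi> u * complex_of_real (g u)) =
    Complex (integral {a..b} (\<lambda>u. Re (\<phi> u) * g u)) (integral {a..b} (\<lambda>u. Im (\<phi> u) * g u))"
proof -
  have "(\<lambda>u. \<phi> u * complex_of_real (g u)) integrable_on {a..b}"
    by (intro integrable_continuous_real continuous_intros assms)
  from integral_linear[OF this bounded_linear_Re] integral_linear[OF this bounded_linear_Im]
  show ?thesis by (simp add: complex_eq_iff o_def)
qed

lemma complex_sine_coeff_split:
  assumes "continuous_on {0..pi} \<phi>"
  shows "complex_sine_coeff \<phi> n = Complex (sine_coeff (\<lambda>u. Re (\<phi> u)) n) (sine_coeff (\<lambda>u. Im (\<phi> u)) n)"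
  unfolding complex_sine_coeff_def sine_coeff_def
  by (intro complex_integral_split assms continuous_intros)

lemma complex_sine_bessel:
  assumes "continuous_on {0..pi} \<phi>"
  shows "summable (\<lambda>n. (cmod (complex_sine_coeff \<phi> (Suc n)))\<^sup>2)"
  unfolding complex_sine_coeff_split[OF assms] cmod_power2 complex.sel
  by (intro summable_add sine_bessel continuous_intros assms)

lemma complex_sine_parseval:
  assumes "continuous_on {0..pi} \<phi>" "continuous_on {0..pi} g"
  shows "(\<lambda>n. complex_sine_coeff \<phi> (Suc n) * complex_of_real (sine_coeff g (Suc n))) sums
    (complex_of_real (pi / 2) * integral {0..pi} (\<lambda>u. \<phi> u * complex_of_real (g u)))"
proof -
  have "continuous_on {0..pi} (\<lambda>u. Re (\<phi> u))" "continuous_on {0..pi} (\<lambda>u. Im (\<phi> u))"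
    by (intro continuous_intros assms)+
  from this[THEN sine_parseval[OF _ assms(2)]] show ?thesis
    unfolding complex_sine_coeff_split[OF assms(1)] complex_integral_split[OF assms] sums_complex_iff
    by simp
qed

theorem theorem9:
  fixes f \<psi> :: "real \<Rightarrow> complex" and C :: real and a :: "nat \<Rightarrow> complex"
  assumes f_repr: "\<And>x. x > 0 \<Longrightarrow> f x / complex_of_real x =
      (LBINT u=-pi..pi. complex_of_real (exp (- x * cosh u)) * \<psi> u * complex_of_real (sinh u))"
    and psi_periodic: "\<And>u. \<psi> (u + 2 * pi) = \<psi> u"
    and C_pos: "C > 0"
    and psi_lipschitz: "\<And>u v. u \<in> {-pi..pi} \<Longrightarrow> v \<in> {-pi..pi} \<Longrightarrow> cmod (\<psi> u - \<psi> v) \<le> C * \<bar>u - v\<bar>"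
    and a_transform: "\<And>n. n \<ge> 1 \<Longrightarrow> a n = kontorovich_lebedev f n"
    and a_summable: "\<And>\<theta>\<^sub>0. 0 \<le> \<theta>\<^sub>0 \<Longrightarrow> \<theta>\<^sub>0 < pi \<Longrightarrow>
      summable (\<lambda>n. cmod (a (Suc n)) * (real (Suc n))\<^sup>2 * exp (\<theta>\<^sub>0 * real (Suc n)))"
  shows "(\<forall>r>0. \<forall>\<theta>\<in>{0..pi}. summable (\<lambda>n. u_term a r \<theta> (Suc n)))
    \<and> (\<forall>\<theta>\<in>{0<..<pi}. summable (\<lambda>n. source_term a \<theta> (Suc n)))
    \<and> solves_helmholtz_polar (u_series a) (helmholtz_source a)
    \<and> uniform_limit {0..pi} (u_series a) (\<lambda>\<theta>. 0) at_top
    \<and> (\<forall>r>0. u_series a r 0 = 0)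
    \<and> (\<forall>r>0. u_series a r pi = f r)"
proof -
  interpret exponentially_decaying a by unfold_locales (rule a_summable)
  have c\<psi>: "continuous_on {-pi..pi} \<psi>"
  proof (rule lipschitz_on_continuous_on)
    show "C-lipschitz_on {-pi..pi} \<psi>"
      using C_pos psi_lipschitz by (auto simp: lipschitz_on_def dist_norm)
  qed
  \<comment> \<open>only the odd part of \<open>\<psi>\<close> matters; \<open>\<phi>\<close> is twice that part, restricted to \<open>[0, pi]\<close>\<close>
  define \<phi> where "\<phi> = (\<lambda>u. \<psi> u - \<psi> (- u))"
  have c\<psi>': "continuous_on {0..pi} \<psi>" "continuous_on {0..pi} (\<lambda>u. \<psi> (- u))"
    using c\<psi> by (auto intro!: continuous_on_compose2[OF c\<psi>] continuous_intros intro: continuous_on_subset)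
  then have c\<phi>: "continuous_on {0..pi} \<phi>" unfolding \<phi>_def by (intro continuous_intros)
  have odd: "(LBINT u:{-pi..pi}. \<psi> u * complex_of_real (g u)) = integral {0..pi} (\<lambda>u. \<phi> u * complex_of_real (g u))"
    if "continuous_on {-pi..pi} g" "\<And>u. g (- u) = - g u" for g
  proof -
    have "continuous_on {-pi..pi} (\<lambda>u. \<psi> u * complex_of_real (g u))"
      by (intro continuous_intros c\<psi> that)
    then have "(LBINT u:{-pi..pi}. \<psi> u * complex_of_real (g u)) = integral {-pi..pi} (\<lambda>u. \<psi> u * complex_of_real (g u))"
      and "integral {-pi..pi} (\<lambda>u. \<psi> u * complex_of_real (g u)) =
        integral {0..pi} (\<lambda>u. \<psi> u * complex_of_real (g u) + \<psi> (- u) * complex_of_real (g (- u)))"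
      by (auto intro!: set_borel_integral_eq_integral borel_integrable_atLeastAtMost' integral_symmetric)
    then show ?thesis by (simp add: \<phi>_def that(2) left_diff_distrib)
  qed
  define b where "b = complex_sine_coeff \<phi>"
  have ab: "complex_of_real (sinh (real n * pi)) * a n = complex_of_real pi * b n" if "n \<ge> 1" for n
  proof -
    have "a n = complex_of_real (pi / sinh (real n * pi)) *
        (LBINT u:{-pi..pi}. \<psi> u * complex_of_real (sin (real n * u)))"
      unfolding a_transform[OF that]
      by (rule kontorovich_lebedev_of_laplace_representation[OF _ c\<psi> that]) (rule f_repr)
    also have "(LBINT u:{-pi..pi}. \<psi> u * complex_of_real (sin (real n * u))) = b n"
      unfolding b_def complex_sine_coeff_def by (rule odd) (auto intro!: continuous_intros)
    finally have "a n = complex_of_real (pi / sinh (real n * pi)) * b n" .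
    moreover have "sinh (real n * pi) \<noteq> 0" using that by simp
    ultimately show ?thesis by simp
  qed
  \<comment> \<open>a summable majorant for the products of the square-summable sequences \<open>b\<close> and \<open>1 / n\<close>\<close>
  define w where "w = (\<lambda>n. (cmod (b n))\<^sup>2 + 1 / (real n)\<^sup>2)"
  have sw: "summable (\<lambda>n. w (Suc n))"
  proof -
    have "summable (\<lambda>n. 1 / (real (Suc n))\<^sup>2)"
      using inverse_power_summable[of 2, where 'a = real] by (subst summable_Suc_iff) (simp add: inverse_eq_divide)
    then show ?thesis
      unfolding w_def b_def by (intro summable_add complex_sine_bessel c\<phi>)
  qed
  have term_le: "cmod (u_term a r \<theta> n) \<le> pi * J_decay r * w n"
    if r: "r \<ge> 0" and \<theta>: "\<theta> \<in> {0..pi}" and n: "n \<ge> 1" for r \<theta> n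
  proof -
    have n': "real n > 0" using n by simp
    have D: "0 \<le> J_decay r" using sq_times_J_le[OF r, of 0] by simp
    have "\<bar>sinh (\<theta> * real n)\<bar> \<le> sinh (real n * pi)"
      using \<theta> n' by (simp add: mult.commute)
    then have "\<bar>sinh (\<theta> * real n)\<bar> * cmod (a n) \<le> sinh (real n * pi) * cmod (a n)"
      by (rule mult_right_mono) simp
    also have "\<dots> = cmod (complex_of_real (sinh (real n * pi)) * a n)"
      by (simp add: norm_mult)
    also have "\<dots> = pi * cmod (b n)" by (simp add: ab[OF n] norm_mult)
    finally have 1: "\<bar>sinh (\<theta> * real n)\<bar> * cmod (a n) \<le> pi * cmod (b n)" .
    have 2: "real n * \<bar>J_deriv 0 n r\<bar> \<le> J_decay r / real n"
      using sq_times_J_le[OF r, of n] n' by (simp add: field_simps power2_eq_square)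
    have "cmod (u_term a r \<theta> n) = (real n * \<bar>J_deriv 0 n r\<bar>) * (\<bar>sinh (\<theta> * real n)\<bar> * cmod (a n))"
      by (simp add: u_term_def incomplete_J_eq norm_mult abs_mult mult_ac)
    also have "\<dots> \<le> (J_decay r / real n) * (pi * cmod (b n))"
      using D n' by (intro mult_mono 1 2) auto
    also have "\<dots> = pi * J_decay r * (cmod (b n) * (1 / real n))" by simp
    also have "\<dots> \<le> pi * J_decay r * w n"
    proof (rule mult_left_mono)
      have "2 * (cmod (b n) * (1 / real n)) \<le> w n"
        using zero_le_power2[of "cmod (b n) - 1 / real n"]
        by (simp add: w_def power2_diff power_divide)
      then show "cmod (b n) * (1 / real n) \<le> w n" using n' by (smt (verit) mult_nonneg_nonneg norm_ge_zero divide_nonneg_nonneg)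
    qed (use D in simp)
    finally show ?thesis .
  qed
  have sum_u: "summable (\<lambda>n. cmod (u_term a r \<theta> (Suc n)))" if "r \<ge> 0" "\<theta> \<in> {0..pi}" for r \<theta>
  proof (rule summable_comparison_test'[OF summable_mult[OF sw]])
    show "norm (cmod (u_term a r \<theta> (Suc n))) \<le> pi * J_decay r * w (Suc n)" for n
      using term_le[OF that, of "Suc n"] by simp
  qed
  have u_le: "cmod (u_series a r \<theta>) \<le> 2 / pi\<^sup>2 * (pi * J_decay r * (\<Sum>n. w (Suc n)))"
    if "r \<ge> 0" "\<theta> \<in> {0..pi}" for r \<theta>
  proof -
    have "cmod (\<Sum>n. u_term a r \<theta> (Suc n)) \<le> (\<Sum>n. cmod (u_term a r \<theta> (Suc n)))"
      by (rule summable_norm[OF sum_u[OF that]])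
    also have "\<dots> \<le> (\<Sum>n. pi * J_decay r * w (Suc n))"
      by (intro suminf_le term_le that sum_u summable_mult sw) simp
    also have "\<dots> = pi * J_decay r * (\<Sum>n. w (Suc n))" by (rule suminf_mult[OF sw])
    finally show ?thesis
      unfolding u_series_def norm_mult by (intro mult_mono) (auto simp: norm_divide norm_power)
  qed
  have "uniform_limit {0..pi} (u_series a) (\<lambda>\<theta>. 0) at_top"
  proof (rule uniform_limitI)
    fix e :: real assume "e > 0"
    have "((\<lambda>r. 2 / pi\<^sup>2 * (pi * J_decay r * (\<Sum>n. w (Suc n)))) \<longlongrightarrow> 2 / pi\<^sup>2 * (pi * 0 * (\<Sum>n. w (Suc n)))) at_top"
      by (intro tendsto_intros J_decay_tendsto_0)
    then have "eventually (\<lambda>r. 2 / pi\<^sup>2 * (pi * J_decay r * (\<Sum>n. w (Suc n))) < e) at_top"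
      using \<open>e > 0\<close> by (intro order_tendstoD(2)) auto
    then show "eventually (\<lambda>r. \<forall>\<theta>\<in>{0..pi}. dist (u_series a r \<theta>) 0 < e) at_top"
      using eventually_ge_at_top[of 0]
    proof eventually_elim
      case (elim r)
      show ?case
      proof
        fix \<theta> assume "\<theta> \<in> {0..pi}"
        from u_le[OF elim(2) this] elim(1) show "dist (u_series a r \<theta>) 0 < e"
          unfolding dist_norm diff_zero by (rule le_less_trans)
      qed
    qed
  qed
  moreover have "u_series a r pi = f r" if "r > 0" for r
  proof -
    have "u_term a r pi n = complex_of_real (r * pi) * (b n * complex_of_real (sine_coeff (sinh_kernel r) n))"
      if "n \<ge> 1" for n
    proof -
      have "u_term a r pi n = complex_of_real (real n * J_deriv 0 n r) * (complex_of_real (sinh (real n * pi)) * a n)"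
        by (simp add: u_term_def incomplete_J_eq mult_ac)
      also have "\<dots> = complex_of_real (r * sine_coeff (sinh_kernel r) n) * (complex_of_real pi * b n)"
        unfolding ab[OF that] times_J_eq_sine_coeff ..
      finally show ?thesis by (simp add: mult_ac)
    qed
    then have "(\<lambda>n. u_term a r pi (Suc n)) sums
       (complex_of_real (r * pi) * (complex_of_real (pi / 2) * integral {0..pi} (\<lambda>u. \<phi> u * complex_of_real (sinh_kernel r u))))"
      unfolding b_def by (simp only: le_add2 Suc_eq_plus1) 
        (intro sums_mult complex_sine_parseval[unfolded Suc_eq_plus1] c\<phi> continuous_on_sinh_kernel)
    then have "u_series a r pi = complex_of_real r * integral {0..pi} (\<lambda>u. \<phi> u * complex_of_real (sinh_kernel r u))"
      unfolding u_series_def by (simp add: sums_unique[symmetric] power2_eq_square)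
    also have "integral {0..pi} (\<lambda>u. \<phi> u * complex_of_real (sinh_kernel r u)) = (LBINT u:{-pi..pi}. \<psi> u * complex_of_real (sinh_kernel r u))"
      by (rule odd[symmetric]) (auto simp: sinh_kernel_def intro!: continuous_intros)
    also have "\<dots> = (LBINT u:{-pi..pi}. complex_of_real (exp (- r * cosh u)) * \<psi> u * complex_of_real (sinh u))"
      by (simp add: sinh_kernel_def mult_ac)
    also have "\<dots> = f r / complex_of_real r"
      unfolding f_repr[OF that] by (rule interval_integral_Icc[symmetric]) simp
    finally show ?thesis using that by simp
  qed
  moreover have "summable (\<lambda>n. u_term a r \<theta> (Suc n))" if "r > 0" "\<theta> \<in> {0..pi}" for r \<theta>
    using sum_u[of r \<theta>] that summable_norm_cancel by auto
  moreover have "u_series a r 0 = 0" for r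
    by (simp add: u_series_def u_term_def)
  ultimately show ?thesis
    using source_term_summable u_series_solves_helmholtz by auto
qed

end
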